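(* Let $n,k\ge1$, $m\ge0$, and let $\Omega\subseteq\mathbb C^{n+m}$ be a domain which is $n$-star-shaped Hartogs in the first $n$ variables $z=(z_1,\dots,z_n)$; write points as $(z,z')$, $z'\in\mathbb C^m$. Let $\gamma_j>0$ ($1\le j\le n$) and $$V^\gamma=\{(z,z',w)\in\mathbb C^{n+m}\times\mathbb C^k:(g_\gamma(z,w),z')\in\Omega\},\qquad g_\gamma(z,w)=\big(e^{\gamma_1\|w\|^2/2}z_1,\dots,e^{\gamma_n\|w\|^2/2}z_n\big).$$ For $\eta\in\mathbb C^k$ let $V^\gamma_\eta=\{(z,z'):(z,z',\eta)\in V^\gamma\}$ with Bergman kernel $K_{V^\gamma_\eta}$. Define $$l(z,w,\eta)=\big(z_1e^{\gamma_1(\langle w,\eta\rangle-\|\eta\|^2)},\dots,z_ne^{\gamma_n(\langle w,\eta\rangle-\|\eta\|^2)}\big),\qquad D_{V^\gamma}=\frac{e^{(\gamma\cdot\mathbf 1)(\langle w,\eta\rangle-\|\eta\|^2)}}{\pi^k}\Big(\sum_{j=1}^n\gamma_j\Big(I+z_j\frac{\partial}{\partial z_j}\Big)\Big)^k.$$ Then for all $(z,z',w;\zeta,\zeta',\eta)\in V^\gamma\times V^\gamma$, $$K_{V^\gamma}(z,z',w;\bar\zeta,\bar\zeta',\bar\eta)=D_{V^\gamma}\Big[K_{V^\gamma_\eta}\big(l(z,w,\eta),z';\bar\zeta,\bar\zeta'\big)\Big].$$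
   Context: A domain $\Omega\subseteq\mathbb C^{n+m}$ is $n$-star-shaped Hartogs in $(z_1,\dots,z_n)$ if $(z_1,\dots,z_n,\zeta)\in\Omega$ implies $(\lambda_1z_1,\dots,\lambda_nz_n,\zeta)\in\Omega$ for all $|\lambda_j|\le1$. $\langle w,\eta\rangle=\sum_{i=1}^k w_i\bar\eta_i$, $\gamma\cdot\mathbf 1=\sum_j\gamma_j$, $I$ is the identity operator. The Bergman kernel is the reproducing kernel of the space of square-integrable holomorphic functions. The operator acts on the function $(z,z',w)\mapsto K_{V^\gamma_\eta}(l(z,w,\eta),z';\bar\zeta,\bar\zeta')$, with $\partial/\partial z_j$ differentiating in $z_j$. *)

theory Defs
  imports "HOL-Analysis.Analysis"
begin

text \<open>Holomorphy in several variables: complex Frechet differentiability.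
  The complex scalar multiplication of the underlying space is the parameter sm.\<close>
definition holo_on_sm :: "(complex \<Rightarrow> 'v::euclidean_space \<Rightarrow> 'v) \<Rightarrow> 'v set \<Rightarrow> ('v \<Rightarrow> complex) \<Rightarrow> bool" where
  "holo_on_sm sm U f \<longleftrightarrow> (\<forall>x\<in>U. \<exists>L. (f has_derivative L) (at x) \<and>
      (\<forall>c v. L (sm c v) = c * L v))"

definition bergman_space_sm :: "(complex \<Rightarrow> 'v::euclidean_space \<Rightarrow> 'v) \<Rightarrow> 'v set \<Rightarrow> ('v \<Rightarrow> complex) set" where
  "bergman_space_sm sm U = {f. holo_on_sm sm U f \<and> set_integrable lborel U (\<lambda>x. (cmod (f x))\<^sup>2)}"

text \<open>K is the Bergman kernel of U: K x y = K(x; conj y), holomorphic in x,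
  reproducing the Bergman space.\<close>
definition is_bergman_kernel_sm ::
  "(complex \<Rightarrow> 'v::euclidean_space \<Rightarrow> 'v) \<Rightarrow> 'v set \<Rightarrow> ('v \<Rightarrow> 'v \<Rightarrow> complex) \<Rightarrow> bool" where
  "is_bergman_kernel_sm sm U K \<longleftrightarrow>
     (\<forall>y\<in>U. (\<lambda>x. K x y) \<in> bergman_space_sm sm U) \<and>
     (\<forall>f\<in>bergman_space_sm sm U. \<forall>y\<in>U.
        f y = set_lebesgue_integral lborel U (\<lambda>x. f x * cnj (K x y)))"

definition is_bergman_kernel :: "(complex^'d) set \<Rightarrow> (complex^'d \<Rightarrow> complex^'d \<Rightarrow> complex) \<Rightarrow> bool" where
  "is_bergman_kernel U K \<longleftrightarrow> is_bergman_kernel_sm (\<lambda>c v. c *s v) U K"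

definition is_bergman_kernel2 ::
  "((complex^'d) \<times> (complex^'k)) set \<Rightarrow> ((complex^'d) \<times> (complex^'k) \<Rightarrow> (complex^'d) \<times> (complex^'k) \<Rightarrow> complex) \<Rightarrow> bool" where
  "is_bergman_kernel2 U K \<longleftrightarrow> is_bergman_kernel_sm (\<lambda>c (a, b). (c *s a, c *s b)) U K"

definition is_domain :: "('a::topological_space) set \<Rightarrow> bool" where
  "is_domain U \<longleftrightarrow> open U \<and> connected U \<and> U \<noteq> {}"

text \<open>Z is the set of indices of the variables z = (z_1..z_n); the other indices
  are the variables z'.\<close>
definition star_hartogs :: "'a set \<Rightarrow> (complex^'a) set \<Rightarrow> bool" where
  "star_hartogs Z \<Omega> \<longleftrightarrow> (\<forall>p\<in>\<Omega>. \<forall>lam::'a \<Rightarrow> complex. (\<forall>j\<in>Z. cmod (lam j) \<le> 1) \<longrightarrow>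
      (\<chi> i. if i \<in> Z then lam i * p$i else p$i) \<in> \<Omega>)"

definition cinner :: "complex^'k \<Rightarrow> complex^'k \<Rightarrow> complex" where
  "cinner w e = (\<Sum>i\<in>UNIV. w$i * cnj (e$i))"

definition g_map :: "'a set \<Rightarrow> ('a \<Rightarrow> real) \<Rightarrow> complex^'a \<Rightarrow> complex^'k \<Rightarrow> complex^'a" where
  "g_map Z \<gamma> x w = (\<chi> i. if i \<in> Z then complex_of_real (exp (\<gamma> i * (norm w)\<^sup>2 / 2)) * x$i else x$i)"

definition V_gamma :: "'a set \<Rightarrow> ('a \<Rightarrow> real) \<Rightarrow> (complex^'a) set \<Rightarrow> ((complex^'a) \<times> (complex^'k)) set" where
  "V_gamma Z \<gamma> \<Omega> = {(x, w). g_map Z \<gamma> x w \<in> \<Omega>}"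

definition V_slice :: "'a set \<Rightarrow> ('a \<Rightarrow> real) \<Rightarrow> (complex^'a) set \<Rightarrow> complex^'k \<Rightarrow> (complex^'a) set" where
  "V_slice Z \<gamma> \<Omega> e = {x. (x, e) \<in> V_gamma Z \<gamma> \<Omega>}"

definition l_map :: "'a set \<Rightarrow> ('a \<Rightarrow> real) \<Rightarrow> complex^'a \<Rightarrow> complex^'k \<Rightarrow> complex^'k \<Rightarrow> complex^'a" where
  "l_map Z \<gamma> x w e = (\<chi> i. if i \<in> Z then
      x$i * exp (complex_of_real (\<gamma> i) * (cinner w e - complex_of_real ((norm e)\<^sup>2))) else x$i)"

definition pderiv_c :: "'a \<Rightarrow> (complex^'a \<Rightarrow> complex) \<Rightarrow> complex^'a \<Rightarrow> complex" where
  "pderiv_c j f x = deriv (\<lambda>t. f (\<chi> i. if i = j then t else x$i)) (x$j)"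

definition euler_op :: "'a set \<Rightarrow> ('a \<Rightarrow> real) \<Rightarrow> (complex^'a \<Rightarrow> complex) \<Rightarrow> complex^'a \<Rightarrow> complex" where
  "euler_op Z \<gamma> f x = (\<Sum>j\<in>Z. complex_of_real (\<gamma> j) * (f x + x$j * pderiv_c j f x))"

end

theory Submission
  imports Defs "HOL-Complex_Analysis.Complex_Analysis" "HOL-Probability.Distributions"
begin

text \<open>
  Write \<open>\<delta>\<^sub>\<tau>\<close> for the scaling of each \<open>z\<^sub>j\<close> by \<open>exp (\<gamma>\<^sub>j \<tau>)\<close>, \<open>c\<close> for the sum of the \<open>\<gamma>\<^sub>j\<close>, and \<open>E\<close> for the
  operator \<open>\<Sum>\<^sub>j \<gamma>\<^sub>j (I + z\<^sub>j \<partial>\<^sub>j)\<close>, so that \<open>E\<close> is minus the generator of the semigroup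
  \<open>S\<^sub>t f = exp (- c t) f \<circ> \<delta>\<^bsub>-t\<^esub>\<close>.

  The automorphisms \<open>(x, w) \<mapsto> (\<delta>\<^bsub>\<langle>w, \<eta>\<rangle> - \<parallel>\<eta>\<parallel>\<^sup>2 / 2\<^esub> x, w - \<eta>)\<close> of \<open>V\<close> reduce everything to \<open>\<eta> = 0\<close>, where the
  slice is \<open>\<Omega>\<close> itself. There the rotations of \<open>w\<close> show that \<open>K\<^sub>V((x, w), (y, 0)) = G x\<close> does not depend on
  \<open>w\<close>. Rotation invariance of \<open>\<Omega>\<close> and the maximum principle give \<open>K (\<delta>\<^bsub>-t\<^esub> x, y) = K (x, \<delta>\<^bsub>-t\<^esub> y)\<close> for the
  kernel \<open>K\<close> of \<open>\<Omega>\<close> and \<open>t \<ge> 0\<close>. Hence \<open>K(\<cdot>, x)\<close>, regarded as a function on \<open>V\<close>, is square integrable, and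
  reproducing it at \<open>(y, 0)\<close> with \<open>K\<^sub>V\<close>, one slice of constant \<open>w\<close> at a time, yields
  \<open>K (x, y) = \<integral> S\<^bsub>\<parallel>w\<parallel>\<^sup>2\<^esub> G (x) dw\<close>. Since \<open>\<parallel>w\<parallel>\<^sup>2\<close> has the density \<open>\<pi>\<^sup>k t\<^bsup>k - 1\<^esup> / (k - 1)!\<close>, this says
  that \<open>K(\<cdot>, y) = \<pi>\<^sup>k E\<^bsup>-k\<^esup> G\<close>.
\<close>

unbundle no fps_syntax

section \<open>Diagonal scalings and Lebesgue measure\<close>

text \<open>Differentiating the integral over \<open>w\<close> would require bounds on derivatives
  of \<open>G\<close> along the flow. They are avoided: with \<open>\<phi> t\<close> the value of
  \<open>S\<^sub>t G\<close> at a point, the integral is pi^k times the k-fold tail integral of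
  \<open>\<phi>\<close>, so k derivatives of \<open>K\<close> along the flow merely undo k
  integrations. The tails converge because \<open>c > 0\<close> and because a backward orbit stays
  in a compact subset of \<Omega>, which bounds \<open>\<phi> t\<close> by a multiple of exp(-c t).

  The fibre of \<open>V\<close> over \<open>w\<close> is \<Omega> scaled by time -|w|^2/2.
  Straightening it produces the Jacobian exp(-c |w|^2), which is at once the Gaussian that makes
  K(., x) square integrable on \<open>V\<close> and the exponential factor of the semigroup. A
  second half of the time |w|^2 appears when the scaling is moved across \<open>K\<close>.

  Reproducing on a fibre requires the scaled \<open>G\<close> to be square integrable over \<Omega>.
  Fubini gives this for almost every \<open>w\<close>, which suffices under the integral.\<close>

definition dscale :: "('a \<Rightarrow> complex) \<Rightarrow> complex^'a \<Rightarrow> complex^'a" where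
  "dscale c x = (\<chi> i. c i * x $ i)"

lemma dscale_nth [simp]: "dscale c x $ i = c i * x $ i"
  by (simp add: dscale_def)

lemma dscale_dscale: "dscale a (dscale b x) = dscale (\<lambda>i. a i * b i) x"
  by (simp add: vec_eq_iff mult.assoc)

lemma dscale_1 [simp]: "dscale (\<lambda>_. 1) x = x"
  by (simp add: vec_eq_iff)

lemma linear_dscale: "linear (dscale c)"
  by (rule linearI) (simp_all add: vec_eq_iff algebra_simps)

lemma bounded_linear_dscale: "bounded_linear (dscale (c :: 'a::finite \<Rightarrow> complex))"
  using linear_dscale by (simp add: linear_conv_bounded_linear)

lemma continuous_on_dscale [continuous_intros]:
  assumes "\<And>i. continuous_on S (\<lambda>t. c t i)" "continuous_on S f"
  shows "continuous_on S (\<lambda>t. dscale (c t) (f t))"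
  unfolding dscale_def by (intro continuous_intros assms)

lemma dscale_measurable [measurable]: "dscale (c :: 'a::finite \<Rightarrow> complex) \<in> borel_measurable borel"
  by (intro borel_measurable_continuous_onI continuous_intros)


text \<open>Fubini for the translates of \<open>A\<close> and \<open>B\<close> along \<open>L\<close>: the usual uniqueness proof for
  translation invariant measures, applied to the image of \<open>lborel\<close> under \<open>L\<close>.\<close>

lemma emeasure_lborel_linear_vimage:
  fixes L S :: "'v::euclidean_space \<Rightarrow> 'v"
  assumes L: "linear L" and LS: "\<And>x. L (S x) = x"
    and B [measurable]: "B \<in> sets borel" and A [measurable]: "A \<in> sets borel"
    and sB: "\<And>x. - x \<in> B \<longleftrightarrow> x \<in> B"
  shows "emeasure lborel A * emeasure lborel (L -` B) = emeasure lborel B * emeasure lborel (L -` A)"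
proof -
  have Lc: "continuous_on UNIV L"
    using L by (simp add: linear_continuous_on linear_conv_bounded_linear)
  have [measurable]: "L \<in> borel_measurable borel"
    using Lc by (rule borel_measurable_continuous_onI)
  have tr: "(\<integral>\<^sup>+x. f (a + x) \<partial>lborel) = (\<integral>\<^sup>+x. f x \<partial>lborel)"
    if "f \<in> borel_measurable borel" for f :: "'v \<Rightarrow> ennreal" and a
    using nn_integral_distr[of "(+) a" lborel borel f] that lborel_distr_plus[of a] by simp
  have vm: "emeasure lborel (L -` X) = (\<integral>\<^sup>+y. indicator X (L y) \<partial>lborel)" if [measurable]: "X \<in> sets borel" for X
  proof -
    have "L -` X \<in> sets borel"
      using measurable_sets[of L borel borel X] by simp
    then have "emeasure lborel (L -` X) = (\<integral>\<^sup>+y. indicator (L -` X) y \<partial>lborel)"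
      by simp
    then show ?thesis by (simp add: indicator_vimage)
  qed
  have trL: "(\<integral>\<^sup>+y. indicator X (x + L y) \<partial>lborel) = emeasure lborel (L -` X)"
    if [measurable]: "X \<in> sets borel" for X x
  proof -
    have "(\<integral>\<^sup>+y. indicator X (x + L y) \<partial>lborel) = (\<integral>\<^sup>+y. indicator X (L (S x + y)) \<partial>lborel :: ennreal)"
      by (simp add: linear_add[OF L] LS)
    also have "\<dots> = (\<integral>\<^sup>+y. indicator X (L y) \<partial>lborel)"
      by (rule tr) measurable
    finally show ?thesis using vm[OF that] by simp
  qed
  have BL: "(\<integral>\<^sup>+y. indicator B (x - L y) \<partial>lborel) = emeasure lborel (L -` B)" for x
  proof -
    have "indicator B (x - L y) = (indicator B (- x + L y) :: ennreal)" for y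
      using sB[of "x - L y"] by (simp add: indicator_def)
    then show ?thesis using trL[OF B, of "- x"] by simp
  qed
  have "emeasure lborel A * emeasure lborel (L -` B)
      = (\<integral>\<^sup>+x. indicator A x * emeasure lborel (L -` B) \<partial>lborel)"
    by (simp add: nn_integral_multc)
  also have "\<dots> = (\<integral>\<^sup>+x. (\<integral>\<^sup>+y. indicator A x * indicator B (x - L y) \<partial>lborel) \<partial>lborel)"
    by (subst nn_integral_cmult) (simp_all add: BL)
  also have "\<dots> = (\<integral>\<^sup>+y. (\<integral>\<^sup>+x. indicator A x * indicator B (x - L y) \<partial>lborel) \<partial>lborel)"
    by (rule lborel_pair.Fubini') (simp add: split_beta')
  also have "\<dots> = (\<integral>\<^sup>+y. (\<integral>\<^sup>+x. indicator A (L y + x) * indicator B x \<partial>lborel) \<partial>lborel)"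
  proof (rule nn_integral_cong)
    fix y
    show "(\<integral>\<^sup>+x. indicator A x * indicator B (x - L y) \<partial>lborel)
      = (\<integral>\<^sup>+x. indicator A (L y + x) * (indicator B x :: ennreal) \<partial>lborel)"
      by (subst tr[of "\<lambda>x. indicator A x * indicator B (x - L y)" "L y", symmetric]) simp_all
  qed
  also have "\<dots> = (\<integral>\<^sup>+x. (\<integral>\<^sup>+y. indicator A (L y + x) * indicator B x \<partial>lborel) \<partial>lborel)"
    by (rule lborel_pair.Fubini') (simp add: split_beta')
  also have "\<dots> = (\<integral>\<^sup>+x. emeasure lborel (L -` A) * indicator B x \<partial>lborel)"
    by (subst nn_integral_multc) (simp_all add: trL add.commute)
  also have "\<dots> = emeasure lborel B * emeasure lborel (L -` A)"
    by (subst nn_integral_cmult) (simp_all add: mult.commute)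
  finally show ?thesis .
qed

text \<open>A complex coordinate consists of the two real basis directions \<open>axis i 1\<close>
  and \<open>axis i \<i>\<close>, both stretched by \<open>r i\<close>; hence the squares in the
  Jacobian.\<close>

lemma dscale_real_lborel:
  fixes r :: "'a::finite \<Rightarrow> real"
  assumes r: "\<And>i. r i > 0"
  shows "lborel = density (distr lborel borel (dscale (\<lambda>i. complex_of_real (r i)))) (\<lambda>_. ennreal (\<Prod>i\<in>UNIV. (r i)\<^sup>2))"
proof -
  \<comment> \<open>A basis vector has exactly one nonzero coordinate, so the choice recovers the
    index of \<open>axis i u\<close>, and \<open>c\<close> is the stretching factor of that
    direction.\<close>
  define c :: "complex^'a \<Rightarrow> real" where "c b = r (SOME i. b $ i \<noteq> 0)" for b
  have c_axis: "c (axis i u) = r i" if "u \<noteq> 0" for i u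
  proof -
    have "(SOME j. (axis i u :: complex^'a) $ j \<noteq> 0) = i"
      using that by (intro some_equality) (auto simp: axis_def split: if_splits)
    then show ?thesis by (simp add: c_def)
  qed
  have cpos: "c j \<noteq> 0" for j using r[of "SOME i. j $ i \<noteq> 0"] by (simp add: c_def)
  have Beq: "(Basis :: (complex^'a) set) = (\<lambda>(i,u). axis i u) ` (UNIV \<times> {1, \<i>})"
    unfolding Basis_vec_def Basis_complex_def by auto
  have inj: "inj_on (\<lambda>(i,u). axis i u :: complex^'a) (UNIV \<times> {1, \<i>})"
    by (auto simp: inj_on_def axis_eq_axis)
  have sumB: "(\<Sum>j\<in>(Basis :: (complex^'a) set). h j) = (\<Sum>i\<in>UNIV. h (axis i 1) + h (axis i \<i>))"
    for h :: "complex^'a \<Rightarrow> complex^'a"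
  proof -
    have "(\<Sum>j\<in>(Basis :: (complex^'a) set). h j) = (\<Sum>(i,u)\<in>UNIV \<times> {1, \<i>}. h (axis i u))"
      unfolding Beq by (subst sum.reindex[OF inj]) (simp add: split_beta')
    also have "\<dots> = (\<Sum>i\<in>UNIV. \<Sum>u\<in>{1, \<i>}. h (axis i u))"
      by (rule sum.cartesian_product[symmetric])
    finally show ?thesis by simp
  qed
  have prodB: "(\<Prod>j\<in>(Basis :: (complex^'a) set). h j) = (\<Prod>i\<in>UNIV. h (axis i 1) * h (axis i \<i>))"
    for h :: "complex^'a \<Rightarrow> real"
  proof -
    have "(\<Prod>j\<in>(Basis :: (complex^'a) set). h j) = (\<Prod>(i,u)\<in>UNIV \<times> {1, \<i>}. h (axis i u))"
      unfolding Beq by (subst prod.reindex[OF inj]) (simp add: split_beta')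
    also have "\<dots> = (\<Prod>i\<in>UNIV. \<Prod>u\<in>{1, \<i>}. h (axis i u))"
      by (rule prod.cartesian_product[symmetric])
    finally show ?thesis by simp
  qed
  have T: "0 + (\<Sum>j\<in>Basis. (c j * (x \<bullet> j)) *\<^sub>R j) = dscale (\<lambda>i. complex_of_real (r i)) x" for x
  proof (rule vec_eq_iff[THEN iffD2], rule allI)
    fix k
    have axk: "(axis i u :: complex^'a) $ k = (if i = k then u else 0)" for i u
      by (simp add: axis_def)
    have "(0 + (\<Sum>j\<in>Basis. (c j * (x \<bullet> j)) *\<^sub>R j)) $ k
        = (\<Sum>i\<in>UNIV. if i = k then complex_of_real (r i) * x $ i else 0)"
      unfolding sumB sum_component add_0
      by (rule sum.cong) (auto simp: c_axis inner_axis axk complex_eq_iff)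
    then show "(0 + (\<Sum>j\<in>Basis. (c j * (x \<bullet> j)) *\<^sub>R j)) $ k = dscale (\<lambda>i. complex_of_real (r i)) x $ k"
      by simp
  qed
  have P: "(\<Prod>j\<in>Basis. \<bar>c j\<bar>) = (\<Prod>i\<in>UNIV. (r i)\<^sup>2)"
    unfolding prodB using r by (simp add: c_axis power2_eq_square)
  show ?thesis
    using lborel_affine_euclidean[of c 0, OF cpos] unfolding T P by simp
qed

text \<open>Phases do not change volume. A linear bijection multiplies Lebesgue measure by a
  constant, and one test set of finite positive measure determines it. The polydisc \<open>B\<close>
  has the same preimage under \<open>c\<close> as under the moduli of \<open>c\<close>, so the
  constant is that of the real case.\<close>

lemma emeasure_dscale_vimage:
  fixes c :: "'a::finite \<Rightarrow> complex"
  assumes c: "\<And>i. c i \<noteq> 0" and A [measurable]: "A \<in> sets borel"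
  shows "emeasure lborel A = ennreal (\<Prod>i\<in>UNIV. (cmod (c i))\<^sup>2) * emeasure lborel (dscale c -` A)"
proof -
  define r where "r i = cmod (c i)" for i
  define B :: "(complex^'a) set" where "B = {x. \<forall>i. cmod (x $ i) \<le> 1}"
  have Beq: "B = (\<Inter>i. {x. cmod (x $ i) \<le> 1})"
    by (auto simp: B_def)
  have clB: "closed B"
    unfolding Beq by (intro closed_INT ballI closed_Collect_le continuous_intros)
  then have [measurable]: "B \<in> sets borel" by simp
  have "norm x \<le> real CARD('a)" if "x \<in> B" for x
  proof -
    have "norm x \<le> (\<Sum>i\<in>UNIV. cmod (x $ i))" unfolding norm_vec_def by (rule L2_set_le_sum) simp
    also have "\<dots> \<le> (\<Sum>i\<in>(UNIV::'a set). 1)" using that by (intro sum_mono) (auto simp: B_def)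
    finally show ?thesis by simp
  qed
  then have "bounded B" by (auto simp: bounded_iff)
  with clB have "compact B" by (simp add: compact_eq_bounded_closed)
  then have fin: "emeasure lborel B < \<infinity>"
    using emeasure_compact_finite by blast
  have "ball 0 1 \<subseteq> B"
  proof
    fix x :: "complex^'a" assume "x \<in> ball 0 1"
    then have "norm x < 1" by simp
    then have "cmod (x $ i) \<le> 1" for i using Finite_Cartesian_Product.norm_nth_le[of x i] by simp
    then show "x \<in> B" by (simp add: B_def)
  qed
  then have "emeasure lborel (ball (0::complex^'a) 1) \<le> emeasure lborel B"
    by (rule emeasure_mono) simp
  moreover have "emeasure lborel (ball (0::complex^'a) 1) > 0"
    by (simp add: emeasure_ball unit_ball_vol_pos)
  ultimately have pos: "emeasure lborel B > 0" by (rule order.strict_trans2[rotated])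
  have inv: "dscale a (dscale (\<lambda>i. inverse (a i)) x) = x" if "\<And>i. a i \<noteq> 0" for a :: "'a \<Rightarrow> complex" and x
    using that by (simp add: dscale_dscale)
  have symB: "- x \<in> B \<longleftrightarrow> x \<in> B" for x by (simp add: B_def)
  have vB: "dscale c -` B = dscale (\<lambda>i. complex_of_real (r i)) -` B"
    by (auto simp: B_def r_def norm_mult)
  have rn: "complex_of_real (r i) \<noteq> 0" for i using c by (simp add: r_def)
  have "emeasure lborel B * emeasure lborel (dscale c -` A)
      = emeasure lborel B * emeasure lborel (dscale (\<lambda>i. complex_of_real (r i)) -` A)"
    using emeasure_lborel_linear_vimage[OF linear_dscale inv, of c B A, OF c _ A symB]
      emeasure_lborel_linear_vimage[OF linear_dscale inv, of "\<lambda>i. complex_of_real (r i)" B A, OF rn _ A symB] vB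
    by simp
  then have eq: "emeasure lborel (dscale c -` A) = emeasure lborel (dscale (\<lambda>i. complex_of_real (r i)) -` A)"
    using fin pos ennreal_mult_cancel_left by auto
  have rpos: "r i > 0" for i using c by (simp add: r_def)
  have "emeasure lborel A = emeasure (density (distr lborel borel (dscale (\<lambda>i. complex_of_real (r i)))) (\<lambda>_. ennreal (\<Prod>i\<in>UNIV. (r i)\<^sup>2))) A"
    using dscale_real_lborel[of r, OF rpos] by metis
  also have "\<dots> = ennreal (\<Prod>i\<in>UNIV. (r i)\<^sup>2) * emeasure lborel (dscale (\<lambda>i. complex_of_real (r i)) -` A)"
    by (simp add: emeasure_density_const emeasure_distr)
  finally show ?thesis unfolding eq by (simp add: r_def)
qed

text \<open>An identity of measures, so that rewriting \<open>lborel\<close> by it yields the change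
  of variables for nonnegative integrals, for Bochner integrals and for integrability alike.\<close>

lemma distr_density_dscale:
  fixes c :: "'a::finite \<Rightarrow> complex"
  assumes c: "\<And>i. c i \<noteq> 0"
  shows "distr (density lborel (\<lambda>_. ennreal (\<Prod>i\<in>UNIV. (cmod (c i))\<^sup>2))) borel (dscale c) = lborel"
proof (rule measure_eqI)
  fix A assume "A \<in> sets (distr (density lborel (\<lambda>_. ennreal (\<Prod>i\<in>UNIV. (cmod (c i))\<^sup>2))) borel (dscale c))"
  then have A [measurable]: "A \<in> sets borel" by simp
  have "dscale c -` A \<in> sets borel"
    using measurable_sets[OF dscale_measurable A] by simp
  then show "emeasure (distr (density lborel (\<lambda>_. ennreal (\<Prod>i\<in>UNIV. (cmod (c i))\<^sup>2))) borel (dscale c)) A = emeasure lborel A"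
    using emeasure_dscale_vimage[OF c A] by (simp add: emeasure_distr emeasure_density_const)
qed simp

lemma nn_integral_dscale:
  fixes c :: "'a::finite \<Rightarrow> complex"
  assumes c: "\<And>i. c i \<noteq> 0" and f [measurable]: "f \<in> borel_measurable borel"
  shows "(\<integral>\<^sup>+x. ennreal (\<Prod>i\<in>UNIV. (cmod (c i))\<^sup>2) * f (dscale c x) \<partial>lborel) = (\<integral>\<^sup>+x. f x \<partial>lborel)"
  by (subst (2) distr_density_dscale[OF c, symmetric])
     (simp add: nn_integral_distr nn_integral_density)

text \<open>The map is triangular: for fixed w it is a diagonal scaling of the first factor, with a
  Jacobian that depends on w alone, and \<open>A\<close> preserves the measure of the second factor.
  Integrating over the first factor innermost gives the claim by Tonelli.\<close>

lemma distr_density_skew: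
  fixes c :: "complex^'k::finite \<Rightarrow> 'a::finite \<Rightarrow> complex" and A :: "complex^'k \<Rightarrow> complex^'k"
  assumes c: "\<And>w i. c w i \<noteq> 0" and cc: "\<And>i. continuous_on UNIV (\<lambda>w. c w i)"
    and A [measurable]: "A \<in> borel_measurable borel" and dA: "distr lborel borel A = lborel"
  shows "distr (density lborel (\<lambda>p. ennreal (\<Prod>i\<in>UNIV. (cmod (c (snd p) i))\<^sup>2))) borel
      (\<lambda>p. (dscale (c (snd p)) (fst p), A (snd p))) = (lborel :: ((complex^'a) \<times> (complex^'k)) measure)"
    (is "distr (density lborel ?j) borel ?T = _")
proof (rule measure_eqI)
  have [measurable]: "(\<lambda>w. c w i) \<in> borel_measurable borel" for i
    using cc by (rule borel_measurable_continuous_onI)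
  have "(\<lambda>p::(complex^'a) \<times> (complex^'k). dscale (c (snd p)) (fst p)) \<in> borel_measurable borel"
    by (intro borel_measurable_continuous_onI continuous_intros continuous_on_compose2[OF cc]) auto
  then have [measurable]: "(\<lambda>p::(complex^'a) \<times> (complex^'k). dscale (c (snd p)) (fst p)) \<in> borel_measurable (borel \<Otimes>\<^sub>M borel)"
    by (simp add: borel_prod)
  have T [measurable]: "?T \<in> borel_measurable (borel \<Otimes>\<^sub>M borel)"
    by (subst borel_prod[symmetric]) measurable
  fix X assume "X \<in> sets (distr (density lborel ?j) borel ?T)"
  then have X': "X \<in> sets borel" by simp
  then have X [measurable]: "X \<in> sets (borel \<Otimes>\<^sub>M borel)" by (subst borel_prod) simp
  have T': "?T \<in> borel_measurable borel" using T by (simp add: borel_prod)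
  have j: "?j \<in> borel_measurable (borel \<Otimes>\<^sub>M borel)" by measurable
  have "emeasure (distr (density lborel ?j) borel ?T) X = (\<integral>\<^sup>+p. indicator X p \<partial>distr (density lborel ?j) borel ?T)"
    using X' by simp
  also have "\<dots> = (\<integral>\<^sup>+p. ?j p * indicator X (?T p) \<partial>lborel)"
  proof -
    have [measurable]: "?j \<in> borel_measurable borel" using j by (simp add: borel_prod)
    note [measurable] = T' X'
    show ?thesis by (subst nn_integral_distr, simp, simp, subst nn_integral_density) simp_all
  qed
  also have "\<dots> = (\<integral>\<^sup>+p. ?j p * indicator X (?T p) \<partial>(lborel \<Otimes>\<^sub>M lborel))"
    by (simp add: lborel_prod)
  also have "\<dots> = (\<integral>\<^sup>+w. (\<integral>\<^sup>+x. ?j (x, w) * indicator X (?T (x, w)) \<partial>lborel) \<partial>lborel)"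
    using j by (subst lborel_pair.nn_integral_snd[symmetric]) (simp_all add: split_beta')
  also have "\<dots> = (\<integral>\<^sup>+w. (\<integral>\<^sup>+x. indicator X (x, A w) \<partial>lborel) \<partial>lborel)"
  proof (rule nn_integral_cong)
    fix w
    show "(\<integral>\<^sup>+x. ?j (x, w) * indicator X (?T (x, w)) \<partial>lborel) = (\<integral>\<^sup>+x. indicator X (x, A w) \<partial>lborel)"
      using nn_integral_dscale[of "c w" "\<lambda>x. indicator X (x, A w)", OF c] by simp
  qed
  also have "\<dots> = (\<integral>\<^sup>+w. (\<integral>\<^sup>+x. indicator X (x, w) \<partial>lborel) \<partial>distr lborel borel A)"
    by (subst nn_integral_distr) simp_all
  also have "\<dots> = (\<integral>\<^sup>+p. indicator X p \<partial>(lborel \<Otimes>\<^sub>M lborel))"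
    unfolding dA by (subst lborel_pair.nn_integral_snd) (simp_all add: split_beta')
  also have "\<dots> = emeasure lborel X"
    using X' by (simp add: lborel_prod)
  finally show "emeasure (distr (density lborel ?j) borel ?T) X = emeasure lborel X" .
qed simp

lemma distr_lborel_rotate_translate:
  fixes a :: "complex^'k::finite"
  assumes "cmod u = 1"
  shows "distr lborel borel (\<lambda>w. u *s w + a) = lborel"
proof -
  have "dscale (\<lambda>_. u) = (\<lambda>w::complex^'k. u *s w)"
    by (auto simp: vec_eq_iff fun_eq_iff)
  then have 1: "distr lborel borel (\<lambda>w::complex^'k. u *s w) = lborel"
    using distr_density_dscale[of "\<lambda>_::'k. u"] assms
    by (fastforce simp: density_1)
  have m: "(\<lambda>w::complex^'k. u *s w) \<in> borel_measurable borel"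
    using dscale_measurable[of "\<lambda>_::'k. u"] by (simp add: \<open>dscale (\<lambda>_. u) = _\<close>)
  have "lborel = distr (distr lborel borel (\<lambda>w::complex^'k. u *s w)) borel ((+) a)"
    unfolding 1 by (simp add: lborel_distr_plus)
  also have "\<dots> = distr lborel borel (\<lambda>w. u *s w + a)"
    using m by (subst distr_distr) (simp_all add: o_def add.commute)
  finally show ?thesis ..
qed

section \<open>Bergman kernels and biholomorphic maps\<close>

lemma holo_on_sm_imp_continuous_on:
  assumes "holo_on_sm sm U f"
  shows "continuous_on U f"
  using assms unfolding holo_on_sm_def
  by (meson continuous_at_imp_continuous_on has_derivative_continuous)

lemma holo_on_sm_const: "holo_on_sm sm U (\<lambda>_. c)"
  unfolding holo_on_sm_def by (auto intro!: exI[of _ "\<lambda>_. 0"])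

lemma holo_on_sm_mult:
  assumes "holo_on_sm sm U f" "holo_on_sm sm U g"
  shows "holo_on_sm sm U (\<lambda>x. f x * g x)"
  unfolding holo_on_sm_def
proof
  fix x assume "x \<in> U"
  with assms obtain L M where
    "(f has_derivative L) (at x)" "\<forall>c v. L (sm c v) = c * L v"
    "(g has_derivative M) (at x)" "\<forall>c v. M (sm c v) = c * M v"
    unfolding holo_on_sm_def by meson
  then show "\<exists>L. ((\<lambda>x. f x * g x) has_derivative L) (at x) \<and> (\<forall>c v. L (sm c v) = c * L v)"
    by (intro exI[of _ "\<lambda>h. f x * M h + L h * g x"] conjI has_derivative_mult)
       (auto simp: algebra_simps)
qed

lemma holo_on_sm_divide:
  assumes "holo_on_sm sm U f" "holo_on_sm sm U g" "\<And>x. x \<in> U \<Longrightarrow> g x \<noteq> 0"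
  shows "holo_on_sm sm U (\<lambda>x. f x / g x)"
  unfolding holo_on_sm_def
proof
  fix x assume x: "x \<in> U"
  with assms obtain L M where
    "(f has_derivative L) (at x)" "\<forall>c v. L (sm c v) = c * L v"
    "(g has_derivative M) (at x)" "\<forall>c v. M (sm c v) = c * M v"
    unfolding holo_on_sm_def by meson
  then show "\<exists>L. ((\<lambda>x. f x / g x) has_derivative L) (at x) \<and> (\<forall>c v. L (sm c v) = c * L v)"
    using assms(3)[OF x]
    by (intro exI[of _ "\<lambda>h. (L h * g x - f x * M h) / (g x * g x)"] conjI has_derivative_divide')
       (auto simp: algebra_simps)
qed

definition holo_map_on :: "(complex \<Rightarrow> 'u::euclidean_space \<Rightarrow> 'u) \<Rightarrow> (complex \<Rightarrow> 'v::euclidean_space \<Rightarrow> 'v)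
    \<Rightarrow> 'u set \<Rightarrow> ('u \<Rightarrow> 'v) \<Rightarrow> bool" where
  "holo_map_on sm sm' U T \<longleftrightarrow> (\<forall>x\<in>U. \<exists>T'. (T has_derivative T') (at x) \<and> (\<forall>c v. T' (sm c v) = sm' c (T' v)))"

lemma holo_on_sm_compose:
  assumes "holo_on_sm sm' U' f" "holo_map_on sm sm' U T" "\<And>x. x \<in> U \<Longrightarrow> T x \<in> U'"
  shows "holo_on_sm sm U (\<lambda>x. f (T x))"
  unfolding holo_on_sm_def
proof
  fix x assume x: "x \<in> U"
  with assms(2) obtain T' where T': "(T has_derivative T') (at x)" "\<forall>c v. T' (sm c v) = sm' c (T' v)"
    unfolding holo_map_on_def by meson
  from assms(1) assms(3)[OF x] obtain L where
    L: "(f has_derivative L) (at (T x))" "\<forall>c v. L (sm' c v) = c * L v"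
    unfolding holo_on_sm_def by meson
  show "\<exists>L. ((\<lambda>x. f (T x)) has_derivative L) (at x) \<and> (\<forall>c v. L (sm c v) = c * L v)"
    using L T' by (intro exI[of _ "\<lambda>h. L (T' h)"] conjI has_derivative_compose[OF T'(1) L(1)]) auto
qed

lemma bergman_space_mult_cnj_integrable:
  assumes U: "open U" and f: "f \<in> bergman_space_sm sm U" and g: "g \<in> bergman_space_sm sm U"
  shows "set_integrable lborel U (\<lambda>x. f x * cnj (g x))"
proof -
  have cf: "continuous_on U f" and cg: "continuous_on U g"
    using f g holo_on_sm_imp_continuous_on by (auto simp: bergman_space_sm_def)
  have "set_integrable lborel U (\<lambda>x. (cmod (f x))\<^sup>2 + (cmod (g x))\<^sup>2)"
    using f g by (auto simp: bergman_space_sm_def intro!: set_integral_add)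
  then show ?thesis
    unfolding set_integrable_def
  proof (rule Bochner_Integration.integrable_bound)
    show "(\<lambda>x. indicator U x *\<^sub>R (f x * cnj (g x))) \<in> borel_measurable lborel"
      using borel_measurable_continuous_on_indicator[of U "\<lambda>x. f x * cnj (g x)"] U cf cg
      by (simp add: continuous_intros)
    show "AE x in lborel. norm (indicator U x *\<^sub>R (f x * cnj (g x)))
        \<le> norm (indicator U x *\<^sub>R ((cmod (f x))\<^sup>2 + (cmod (g x))\<^sup>2))"
    proof (rule AE_I2)
      fix x
      have "cmod (f x) * cmod (g x) \<le> (cmod (f x))\<^sup>2 + (cmod (g x))\<^sup>2"
        using sum_squares_bound[of "cmod (f x)" "cmod (g x)"]
          mult_nonneg_nonneg[OF norm_ge_zero[of "f x"] norm_ge_zero[of "g x"]] by linarith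
      then show "norm (indicator U x *\<^sub>R (f x * cnj (g x)))
        \<le> norm (indicator U x *\<^sub>R ((cmod (f x))\<^sup>2 + (cmod (g x))\<^sup>2))"
        by (simp add: norm_mult indicator_def)
    qed
  qed
qed

lemma set_lebesgue_integral_cnj:
  "set_lebesgue_integral M A (\<lambda>x. cnj (f x)) = cnj (set_lebesgue_integral M A f)"
  unfolding set_lebesgue_integral_def
  by (simp flip: Bochner_Integration.integral_cnj)

lemma bergman_kernel_in_space:
  assumes "is_bergman_kernel_sm sm U K" "y \<in> U"
  shows "(\<lambda>x. K x y) \<in> bergman_space_sm sm U"
  using assms unfolding is_bergman_kernel_sm_def by blast

lemma bergman_kernel_reproduces:
  assumes "is_bergman_kernel_sm sm U K" "f \<in> bergman_space_sm sm U" "y \<in> U"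
  shows "f y = set_lebesgue_integral lborel U (\<lambda>x. f x * cnj (K x y))"
  using assms unfolding is_bergman_kernel_sm_def by blast

text \<open>Reproduce \<open>K' _ y\<close> at x with \<open>K\<close>, and \<open>K _ x\<close> at
  y with \<open>K'\<close>: the two integrals are conjugate. Taking \<open>K' = K\<close> gives
  Hermitian symmetry, and comparing the two versions gives uniqueness.\<close>

lemma bergman_kernel_cross:
  assumes K: "is_bergman_kernel_sm sm U K" and K': "is_bergman_kernel_sm sm U K'" and x: "x \<in> U" and y: "y \<in> U"
  shows "K' x y = cnj (K y x)"
proof -
  have "K' x y = set_lebesgue_integral lborel U (\<lambda>z. K' z y * cnj (K z x))"
    by (rule bergman_kernel_reproduces[OF K bergman_kernel_in_space[OF K' y] x])
  moreover have "K y x = set_lebesgue_integral lborel U (\<lambda>z. K z x * cnj (K' z y))"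
    by (rule bergman_kernel_reproduces[OF K' bergman_kernel_in_space[OF K x] y])
  moreover have "set_lebesgue_integral lborel U (\<lambda>z. K' z y * cnj (K z x))
     = cnj (set_lebesgue_integral lborel U (\<lambda>z. K z x * cnj (K' z y)))"
    by (subst set_lebesgue_integral_cnj[symmetric]) (simp add: mult.commute)
  ultimately show ?thesis by simp
qed

lemmas bergman_kernel_hermitian = bergman_kernel_cross[where K' = K and K = K for K]

lemma bergman_kernel_unique:
  assumes "is_bergman_kernel_sm sm U K" "is_bergman_kernel_sm sm U K'" "x \<in> U" "y \<in> U"
  shows "K x y = K' x y"
  using bergman_kernel_cross[OF assms(1,1,3,4)] bergman_kernel_cross[OF assms(1-4)] by simp

text \<open>Composing with T and multiplying by J is a unitary map from the Bergman space of U' onto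
  that of U; \<open>pull\<close> and \<open>push\<close> are this map and its inverse. J stands for
  the complex Jacobian determinant but is tied to T only through the density, so it may differ from
  the determinant by a phase.\<close>

lemma bergman_kernel_transform:
  fixes T S :: "'v::euclidean_space \<Rightarrow> 'v" and J :: "'v \<Rightarrow> complex"
  assumes U: "open U" and U': "open U'"
    and TU: "\<And>x. T x \<in> U' \<longleftrightarrow> x \<in> U" and ST: "\<And>x. S (T x) = x" and TS: "\<And>x. T (S x) = x"
    and hT: "holo_map_on sm sm U T" and hS: "holo_map_on sm sm U' S"
    and J: "holo_on_sm sm U J" and J0: "\<And>x. J x \<noteq> 0"
    and Tm [measurable]: "T \<in> borel_measurable borel" and Jm [measurable]: "J \<in> borel_measurable borel"
    and distr: "distr (density lborel (\<lambda>x. ennreal ((cmod (J x))\<^sup>2))) borel T = lborel"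
    and K: "is_bergman_kernel_sm sm U' K"
  shows "is_bergman_kernel_sm sm U (\<lambda>x y. J x * cnj (J y) * K (T x) (T y))"
proof -
  have ind: "indicator U' (T x) = (indicator U x :: real)" for x
    using TU[of x] by (simp add: indicator_def)
  have SU: "S y \<in> U \<longleftrightarrow> y \<in> U'" for y
    using TU[of "S y"] TS by simp
  have int_eq: "set_integrable lborel U' F \<longleftrightarrow> set_integrable lborel U (\<lambda>x. (cmod (J x))\<^sup>2 *\<^sub>R F (T x))"
    if [measurable]: "(\<lambda>x. indicator U' x *\<^sub>R F x) \<in> borel_measurable borel"
    for F :: "'v \<Rightarrow> 'b::{banach, second_countable_topology}"
  proof -
    have "set_integrable lborel U' F \<longleftrightarrow> integrable (distr (density lborel (\<lambda>x. ennreal ((cmod (J x))\<^sup>2))) borel T) (\<lambda>y. indicator U' y *\<^sub>R F y)"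
      unfolding distr set_integrable_def ..
    also have "\<dots> \<longleftrightarrow> integrable lborel (\<lambda>x. (cmod (J x))\<^sup>2 *\<^sub>R (indicator U' (T x) *\<^sub>R F (T x)))"
      by (subst integrable_distr_eq, simp, simp, subst integrable_density) simp_all
    finally show ?thesis
      by (simp add: set_integrable_def ind mult.commute)
  qed
  have integral_eq: "set_lebesgue_integral lborel U' F = set_lebesgue_integral lborel U (\<lambda>x. (cmod (J x))\<^sup>2 *\<^sub>R F (T x))"
    if [measurable]: "(\<lambda>x. indicator U' x *\<^sub>R F x) \<in> borel_measurable borel"
    for F :: "'v \<Rightarrow> 'b::{banach, second_countable_topology}"
  proof -
    have "set_lebesgue_integral lborel U' F = integral\<^sup>L (distr (density lborel (\<lambda>x. ennreal ((cmod (J x))\<^sup>2))) borel T) (\<lambda>y. indicator U' y *\<^sub>R F y)"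
      unfolding distr set_lebesgue_integral_def ..
    also have "\<dots> = integral\<^sup>L lborel (\<lambda>x. (cmod (J x))\<^sup>2 *\<^sub>R (indicator U' (T x) *\<^sub>R F (T x)))"
      by (subst integral_distr, simp, simp, subst integral_density) simp_all
    finally show ?thesis
      by (simp add: set_lebesgue_integral_def ind mult.commute)
  qed
  have sq_meas: "(\<lambda>x. indicator U' x *\<^sub>R (cmod (f x))\<^sup>2) \<in> borel_measurable borel"
    if "holo_on_sm sm U' f" for f
    using U' holo_on_sm_imp_continuous_on[OF that]
    by (intro borel_measurable_continuous_on_indicator continuous_intros) auto
  have pull: "(\<lambda>x. J x * f (T x)) \<in> bergman_space_sm sm U" if f: "f \<in> bergman_space_sm sm U'" for f
  proof -
    have hf: "holo_on_sm sm U' f" and "set_integrable lborel U' (\<lambda>x. (cmod (f x))\<^sup>2)"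
      using f by (auto simp: bergman_space_sm_def)
    then have "set_integrable lborel U (\<lambda>x. (cmod (J x * f (T x)))\<^sup>2)"
      using int_eq[OF sq_meas[OF hf]] by (simp add: norm_mult power_mult_distrib)
    moreover have "holo_on_sm sm U (\<lambda>x. J x * f (T x))"
      using TU by (intro holo_on_sm_mult J holo_on_sm_compose[OF hf hT]) auto
    ultimately show ?thesis by (simp add: bergman_space_sm_def)
  qed
  have push: "(\<lambda>y. f (S y) / J (S y)) \<in> bergman_space_sm sm U'" if f: "f \<in> bergman_space_sm sm U" for f
  proof -
    have hf: "holo_on_sm sm U f" and i: "set_integrable lborel U (\<lambda>x. (cmod (f x))\<^sup>2)"
      using f by (auto simp: bergman_space_sm_def)
    have h: "holo_on_sm sm U' (\<lambda>y. f (S y) / J (S y))"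
      using SU J0 by (intro holo_on_sm_divide holo_on_sm_compose[OF hf hS] holo_on_sm_compose[OF J hS]) auto
    have "set_integrable lborel U' (\<lambda>y. (cmod (f (S y) / J (S y)))\<^sup>2)"
      unfolding int_eq[OF sq_meas[OF h]]
      using i J0 by (simp add: norm_divide power_divide ST)
    with h show ?thesis by (simp add: bergman_space_sm_def)
  qed
  show ?thesis
    unfolding is_bergman_kernel_sm_def
  proof (intro conjI ballI)
    fix y assume y: "y \<in> U"
    have "(\<lambda>x. cnj (J y) * K x (T y)) \<in> bergman_space_sm sm U'"
    proof -
      have "(\<lambda>x. K x (T y)) \<in> bergman_space_sm sm U'"
        using K y TU unfolding is_bergman_kernel_sm_def by blast
      then show ?thesis
        by (auto simp: bergman_space_sm_def norm_mult power_mult_distrib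
            intro!: holo_on_sm_mult holo_on_sm_const)
    qed
    from pull[OF this] show "(\<lambda>x. J x * cnj (J y) * K (T x) (T y)) \<in> bergman_space_sm sm U"
      by (simp add: mult.assoc)
  next
    fix f y assume f: "f \<in> bergman_space_sm sm U" and y: "y \<in> U"
    define h where "h z = f (S z) / J (S z)" for z
    have h: "h \<in> bergman_space_sm sm U'" unfolding h_def using push[OF f] .
    have Ky: "(\<lambda>x. K x (T y)) \<in> bergman_space_sm sm U'"
      using K y TU unfolding is_bergman_kernel_sm_def by blast
    have meas: "(\<lambda>z. indicator U' z *\<^sub>R (h z * cnj (K z (T y)))) \<in> borel_measurable borel"
      using U' h Ky holo_on_sm_imp_continuous_on
      by (intro borel_measurable_continuous_on_indicator continuous_intros) (auto simp: bergman_space_sm_def)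
    have "f y = J y * h (T y)" using J0 by (simp add: h_def ST)
    also have "h (T y) = set_lebesgue_integral lborel U' (\<lambda>z. h z * cnj (K z (T y)))"
      using K h y TU unfolding is_bergman_kernel_sm_def by blast
    also have "\<dots> = set_lebesgue_integral lborel U (\<lambda>x. (cmod (J x))\<^sup>2 *\<^sub>R (h (T x) * cnj (K (T x) (T y))))"
      by (rule integral_eq[OF meas])
    \<comment> \<open>The density is J times its conjugate: the first factor turns \<open>h\<close>
      composed with T back into f, the second becomes part of the new kernel.\<close>
    also have "(\<lambda>x. (cmod (J x))\<^sup>2 *\<^sub>R (h (T x) * cnj (K (T x) (T y)))) = (\<lambda>x. f x * cnj (J x) * cnj (K (T x) (T y)))"
    proof
      fix x
      have "complex_of_real ((cmod (J x))\<^sup>2) = J x * cnj (J x)"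
        by (rule complex_norm_square)
      then show "(cmod (J x))\<^sup>2 *\<^sub>R (h (T x) * cnj (K (T x) (T y))) = f x * cnj (J x) * cnj (K (T x) (T y))"
        using J0[of x] by (simp add: scaleR_conv_of_real h_def ST)
    qed
    also have "J y * set_lebesgue_integral lborel U (\<lambda>x. f x * cnj (J x) * cnj (K (T x) (T y)))
        = set_lebesgue_integral lborel U (\<lambda>x. J y * (f x * cnj (J x) * cnj (K (T x) (T y))))"
      by (rule set_integral_mult_right[symmetric])
    also have "(\<lambda>x. J y * (f x * cnj (J x) * cnj (K (T x) (T y)))) = (\<lambda>x. f x * cnj (J x * cnj (J y) * K (T x) (T y)))"
      by (simp add: fun_eq_iff)
    finally show "f y = set_lebesgue_integral lborel U (\<lambda>x. f x * cnj (J x * cnj (J y) * K (T x) (T y)))" .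
  qed
qed

section \<open>Directional derivatives of holomorphic functions\<close>

lemma holo_on_sm_line:
  assumes f: "holo_on_sm sm U f" and v: "bounded_linear (\<lambda>l. sm l v)"
  shows "(\<lambda>l. f (p + sm l v)) holomorphic_on {l. p + sm l v \<in> U}"
  unfolding holomorphic_on_def
proof
  fix l assume "l \<in> {l. p + sm l v \<in> U}"
  with f obtain L where L: "(f has_derivative L) (at (p + sm l v))" "\<forall>c v. L (sm c v) = c * L v"
    unfolding holo_on_sm_def by blast
  have "((\<lambda>l. p + sm l v) has_derivative (\<lambda>h. sm h v)) (at l)"
    using has_derivative_add[OF has_derivative_const bounded_linear_imp_has_derivative[OF v]] by simp
  from has_derivative_compose[OF this L(1)] L(2)
  have "((\<lambda>l. f (p + sm l v)) has_derivative (\<lambda>h. h * L v)) (at l)" by simp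
  then show "(\<lambda>l. f (p + sm l v)) field_differentiable at l within {l. p + sm l v \<in> U}"
    unfolding field_differentiable_def has_field_derivative_def
    by (metis (no_types, lifting) ext has_derivative_at_withinI mult.commute)
qed

lemma open_line_vimage:
  assumes "open U" "bounded_linear (\<lambda>l. sm l v)"
  shows "open {l. p + sm l v \<in> U}"
proof -
  have "continuous_on UNIV (\<lambda>l. p + sm l v)"
    using assms(2) by (intro continuous_intros linear_continuous_on)
  from continuous_open_vimage[OF assms(1)] this show ?thesis
    by (auto simp: vimage_def continuous_on_eq_continuous_at)
qed

text \<open>Maximum modulus for the difference. It spreads rotation invariance from circles to the
  discs that they bound.\<close>

lemma holomorphic_eq_on_cball:
  assumes f: "f holomorphic_on W" and g: "g holomorphic_on W" and W: "open W" "cball 0 1 \<subseteq> W"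
    and eq: "\<And>z. cmod z = 1 \<Longrightarrow> f z = g z" and z: "cmod z \<le> 1"
  shows "f z = g z"
proof -
  have h: "(\<lambda>z. f z - g z) holomorphic_on W" using f g by (intro holomorphic_intros)
  have "cmod (f z - g z) \<le> 0"
  proof (rule maximum_modulus_frontier[of "\<lambda>z. f z - g z" "cball 0 1"])
    show "(\<lambda>z. f z - g z) holomorphic_on interior (cball 0 1)"
      using h W(2) by (rule holomorphic_on_subset[OF _ order.trans[OF interior_subset]])
    show "continuous_on (closure (cball 0 1)) (\<lambda>z. f z - g z)"
      using holomorphic_on_imp_continuous_on[OF holomorphic_on_subset[OF h W(2)]] by simp
  qed (use eq z in \<open>auto simp: dist_norm\<close>)
  then show ?thesis by simp
qed

text \<open>Cauchy's formula with the circle parametrized over the unit interval: the derivative of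
  \<open>e\<close> is 2 pi i times \<open>e\<close>, which cancels the constant and one power of
  \<open>e\<close>. As an integral over a compact interval it admits the theorems on
  parameter-dependent integrals.\<close>

lemma deriv_circle_mean:
  assumes g: "g holomorphic_on W" and W: "cball 0 r \<subseteq> W" and r: "r > 0"
  defines "e \<equiv> \<lambda>t. complex_of_real r * exp (2 * of_real pi * \<i> * of_real t)"
  shows "deriv g 0 = integral {0..1} (\<lambda>t. g (e t) / e t)"
proof -
  have gs: "g holomorphic_on cball 0 r" using g W holomorphic_on_subset by blast
  have "(g has_field_derivative (1/(2 * of_real pi * \<i>) * contour_integral (circlepath 0 r) (\<lambda>u. g u / (u - 0)^2))) (at 0)"
    using gs r by (intro Cauchy_derivative_integral_circlepath)
      (auto intro: holomorphic_on_imp_continuous_on holomorphic_on_subset ball_subset_cball)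
  then have "deriv g 0 = 1/(2 * of_real pi * \<i>) * contour_integral (circlepath 0 r) (\<lambda>u. g u / (u - 0)^2)"
    by (rule DERIV_imp_deriv)
  also have "contour_integral (circlepath 0 r) (\<lambda>u. g u / (u - 0)^2)
      = integral {0..1} (\<lambda>t. (2 * of_real pi * \<i>) * (g (e t) / e t))"
    unfolding contour_integral_integral vector_derivative_circlepath
    using r by (intro integral_cong) (simp add: circlepath e_def power2_eq_square divide_simps)
  finally show ?thesis unfolding integral_mult_right by simp
qed

lemma norm_vector_scalar_mult_complex: "norm (l *s v) = cmod l * norm (v :: complex^'a::finite)"
  by (simp add: norm_vec_def norm_mult L2_set_right_distrib)

lemma bounded_linear_vector_scalar_mult_left: "bounded_linear (\<lambda>l. l *s (v :: complex^'a::finite))"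
proof (rule bounded_linear_intro[where K = "norm v"])
  show "norm (l *s v) \<le> norm l * norm v" for l by (simp add: norm_vector_scalar_mult_complex)
qed (simp_all add: vec_eq_iff algebra_simps)

lemma holo_derivative_circle_mean:
  fixes f :: "complex^'a::finite \<Rightarrow> complex"
  assumes U: "open U" and f: "holo_on_sm (*s) U f"
    and L: "(f has_derivative L) (at x)" "\<And>c v. L (c *s v) = c * L v"
    and r: "r > 0" "\<And>l. cmod l \<le> r \<Longrightarrow> x + l *s v \<in> U"
  defines "e \<equiv> \<lambda>t. complex_of_real r * exp (2 * of_real pi * \<i> * of_real t)"
  shows "L v = integral {0..1} (\<lambda>t. f (x + e t *s v) / e t)"
proof -
  note bl = bounded_linear_vector_scalar_mult_left[of v]
  have "((\<lambda>l. x + l *s v) has_derivative (\<lambda>h. h *s v)) (at 0)"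
    using has_derivative_add[OF has_derivative_const bounded_linear_imp_has_derivative[OF bl]] by simp
  moreover have "(f has_derivative L) (at (x + 0 *s v))" using L(1) by simp
  ultimately have "((\<lambda>l. f (x + l *s v)) has_derivative (\<lambda>h. L (h *s v))) (at 0)"
    by (rule has_derivative_compose)
  then have "((\<lambda>l. f (x + l *s v)) has_field_derivative L v) (at 0)"
    unfolding has_field_derivative_def L(2) by (simp add: mult.commute[of _ "L v"])
  then have "L v = deriv (\<lambda>l. f (x + l *s v)) 0"
    by (rule DERIV_imp_deriv[symmetric])
  also have "\<dots> = integral {0..1} (\<lambda>t. f (x + e t *s v) / e t)"
    unfolding e_def
    by (rule deriv_circle_mean[OF holo_on_sm_line[OF f bl]]) (use r in auto)
  finally show ?thesis .
qed

text \<open>\<open>holo_on_sm\<close> asks for a derivative at each point and says nothing about how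
  it varies. Cauchy's formula turns \<open>D x v\<close> into a mean of values of f over a circle,
  and such means inherit regularity from f. This is what allows \<open>euler_op\<close> to be
  iterated.\<close>

lemma holo_on_sm_directional_derivative:
  fixes f :: "complex^'a::finite \<Rightarrow> complex"
  assumes U: "open U" and f: "holo_on_sm (*s) U f"
  shows "holo_on_sm (*s) U (\<lambda>x. frechet_derivative f (at x) v)"
proof -
  obtain D where D: "\<And>x. x \<in> U \<Longrightarrow> (f has_derivative D x) (at x)" "\<And>x c v. x \<in> U \<Longrightarrow> D x (c *s v) = c * D x v"
    using f unfolding holo_on_sm_def by metis
  have D_eq: "frechet_derivative f (at x) = D x" if "x \<in> U" for x
    using frechet_derivative_at[OF D(1)[OF that]] by simp
  have cf: "continuous_on U f" using f by (rule holo_on_sm_imp_continuous_on)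
  have near: "\<exists>\<rho>>0. \<exists>r>0. \<forall>x\<in>ball x0 \<rho>. \<forall>l. cmod l \<le> r \<longrightarrow> x + l *s v \<in> U" if x0: "x0 \<in> U" for x0 v
  proof -
    obtain R where R: "R > 0" "cball x0 R \<subseteq> U" using U x0 open_contains_cball by blast
    \<comment> \<open>Circles of one radius must serve all centers near \<open>x0\<close>: half of
      \<open>R\<close> is kept for the center and half for the circle. Adding 1 avoids a division by
      zero for v = 0.\<close>
    define r where "r = R / (2 * (norm v + 1))"
    have r: "r > 0" using R by (simp add: r_def add_nonneg_pos)
    have "x + l *s v \<in> U" if x: "x \<in> ball x0 (R/2)" and l: "cmod l \<le> r" for x l
    proof -
      have "norm (l *s v) \<le> r * (norm v + 1)"
        unfolding norm_vector_scalar_mult_complex using l r by (intro mult_mono) auto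
      also have "\<dots> = R / 2"
        using add_nonneg_pos[OF norm_ge_zero[of v] zero_less_one] by (simp add: r_def field_simps)
      finally have "norm (l *s v) \<le> R / 2" .
      moreover have "norm (x - x0) < R/2" using x by (simp add: dist_norm norm_minus_commute)
      ultimately have "norm (x + l *s v - x0) \<le> R"
        using norm_triangle_ineq[of "x - x0" "l *s v"] by (simp add: algebra_simps)
      then have "x + l *s v \<in> cball x0 R" by (simp add: dist_norm norm_minus_commute)
      then show ?thesis using R by blast
    qed
    then show ?thesis using R r by (intro exI[of _ "R/2"] conjI exI[of _ r]) auto
  qed
  \<comment> \<open>Continuity comes first because differentiation under the integral sign, below,
    needs it for the derivative of the integrand.\<close>
  have cD: "continuous_on U (\<lambda>x. D x v)" for v
  proof (rule continuous_at_imp_continuous_on, rule ballI)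
    fix x0 assume x0: "x0 \<in> U"
    from near[OF this, of v] obtain \<rho> r where \<rho>: "\<rho> > 0" "r > 0"
      and inU: "\<And>x l. x \<in> ball x0 \<rho> \<Longrightarrow> cmod l \<le> r \<Longrightarrow> x + l *s v \<in> U" by blast
    define e where "e = (\<lambda>t. complex_of_real r * exp (2 * of_real pi * \<i> * of_real t))"
    have e: "e t \<noteq> 0" "cmod (e t) = r" for t
      using \<rho> by (auto simp: e_def norm_mult)
    have inB: "x \<in> U" if "x \<in> ball x0 \<rho>" for x using inU[OF that, of 0] \<rho> by simp
    have eq: "D x v = integral (cbox 0 1) (\<lambda>t. f (x + e t *s v) / e t)" if "x \<in> ball x0 \<rho>" for x
      unfolding e_def cbox_interval
      by (rule holo_derivative_circle_mean[OF U f D(1) D(2)]) (use that inU inB \<rho> in auto)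
    have "continuous_on (ball x0 \<rho> \<times> cbox (0::real) 1) (\<lambda>(x, t). f (x + e t *s v) / e t)"
      unfolding split_beta'
    proof (intro continuous_on_divide continuous_on_compose2[OF cf])
      show "continuous_on (ball x0 \<rho> \<times> cbox (0::real) 1) (\<lambda>p. e (snd p))"
        unfolding e_def by (intro continuous_intros)
      then show "continuous_on (ball x0 \<rho> \<times> cbox (0::real) 1) (\<lambda>p. fst p + e (snd p) *s v)"
        by (intro continuous_intros continuous_on_compose2[OF linear_continuous_on[OF bounded_linear_vector_scalar_mult_left]]) auto
    qed (use e inU in auto)
    then have "continuous_on (ball x0 \<rho>) (\<lambda>x. integral (cbox 0 1) (\<lambda>t. f (x + e t *s v) / e t))"
      by (rule integral_continuous_on_param)
    then have "continuous_on (ball x0 \<rho>) (\<lambda>x. D x v)"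
      by (rule continuous_on_eq) (simp add: eq)
    then show "isCont (\<lambda>x. D x v) x0"
      using \<rho> by (auto simp: continuous_on_eq_continuous_at)
  qed
  have "holo_on_sm (*s) U (\<lambda>x. D x v)"
    unfolding holo_on_sm_def
  proof
    fix x0 assume x0: "x0 \<in> U"
    from near[OF this, of v] obtain \<rho> r where \<rho>: "\<rho> > 0" "r > 0"
      and inU: "\<And>x l. x \<in> ball x0 \<rho> \<Longrightarrow> cmod l \<le> r \<Longrightarrow> x + l *s v \<in> U" by blast
    define e where "e = (\<lambda>t. complex_of_real r * exp (2 * of_real pi * \<i> * of_real t))"
    have e: "e t \<noteq> 0" "cmod (e t) = r" for t
      using \<rho> by (auto simp: e_def norm_mult)
    have ce: "continuous_on S e" for S unfolding e_def by (intro continuous_intros)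
    have inB: "x \<in> U" if "x \<in> ball x0 \<rho>" for x using inU[OF that, of 0] \<rho> by simp
    have inE: "x + e t *s v \<in> U" if "x \<in> ball x0 \<rho>" for x t using inU[OF that] e by simp
    have eq: "D x v = integral (cbox 0 1) (\<lambda>t. f (x + e t *s v) / e t)" if "x \<in> ball x0 \<rho>" for x
      unfolding e_def cbox_interval
      by (rule holo_derivative_circle_mean[OF U f D(1) D(2)]) (use that inU inB \<rho> in auto)
    \<comment> \<open>The Leibniz rule takes derivatives as elements of the normed space of bounded
      linear maps. In finite dimension their continuity may be tested on basis vectors, which is
      where \<open>cD\<close> enters.\<close>
    define B where "B x t = Blinfun (\<lambda>h. D (x + e t *s v) h / e t)" for x t
    have B: "blinfun_apply (B x t) = (\<lambda>h. D (x + e t *s v) h / e t)" if "x \<in> ball x0 \<rho>" for x t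
    proof -
      have "bounded_linear (D (x + e t *s v))"
        using D(1)[OF inE[OF that]] by (rule has_derivative_bounded_linear)
      then have "bounded_linear (\<lambda>h. D (x + e t *s v) h / e t)"
        by (rule bounded_linear_compose[OF bounded_linear_divide])
      then show ?thesis unfolding B_def by (rule bounded_linear_Blinfun_apply)
    qed
    have shift: "continuous_on X (\<lambda>p. fst p + e (snd p) *s v)" for X
      by (intro continuous_intros continuous_on_compose2[OF linear_continuous_on[OF bounded_linear_vector_scalar_mult_left]]
           continuous_on_compose2[OF ce]) auto
    have "((\<lambda>x. integral (cbox 0 1) (\<lambda>t. f (x + e t *s v) / e t)) has_derivative
        blinfun_apply (integral (cbox 0 1) (B x0))) (at x0 within ball x0 \<rho>)"
    proof (rule leibniz_rule)
      fix x t assume x: "x \<in> ball x0 \<rho>"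
      have "((\<lambda>x. x + e t *s v) has_derivative (\<lambda>h. h)) (at x)"
        by (auto intro!: derivative_eq_intros)
      from has_derivative_compose[OF this D(1)[OF inE[OF x]]]
      have "((\<lambda>x. f (x + e t *s v)) has_derivative D (x + e t *s v)) (at x)" .
      then have "((\<lambda>x. f (x + e t *s v) / e t) has_derivative (\<lambda>h. D (x + e t *s v) h / e t)) (at x)"
        by (auto intro!: derivative_eq_intros simp: e)
      then show "((\<lambda>x. f (x + e t *s v) / e t) has_derivative blinfun_apply (B x t)) (at x within ball x0 \<rho>)"
        unfolding B[OF x] by (rule has_derivative_at_withinI)
    next
      fix x assume x: "x \<in> ball x0 \<rho>"
      show "(\<lambda>t. f (x + e t *s v) / e t) integrable_on cbox 0 1"
        by (intro integrable_continuous continuous_on_divide ce continuous_on_compose2[OF cf] continuous_intros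
            continuous_on_compose2[OF linear_continuous_on[OF bounded_linear_vector_scalar_mult_left]])
           (use e inE[OF x] in auto)
    next
      show "continuous_on (ball x0 \<rho> \<times> cbox 0 1) (\<lambda>(x, t). B x t)"
      proof (rule continuous_on_blinfun_componentwise)
        fix b :: "complex^'a"
        have "continuous_on (ball x0 \<rho> \<times> cbox 0 1) (\<lambda>p. D (fst p + e (snd p) *s v) b / e (snd p))"
          by (intro continuous_on_divide continuous_on_compose2[OF cD] shift continuous_on_compose2[OF ce] continuous_intros)
             (use e inE in auto)
        then show "continuous_on (ball x0 \<rho> \<times> cbox 0 1) (\<lambda>p. blinfun_apply (case p of (x, t) \<Rightarrow> B x t) b)"
          by (rule continuous_on_eq) (auto simp: B)
      qed
    qed (use \<rho> in auto)
    then have "((\<lambda>x. D x v) has_derivative blinfun_apply (integral (cbox 0 1) (B x0))) (at x0 within ball x0 \<rho>)"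
      by (rule has_derivative_transform[rotated 2]) (use \<rho> eq in auto)
    then have d: "((\<lambda>x. D x v) has_derivative blinfun_apply (integral (cbox 0 1) (B x0))) (at x0)"
      using \<rho> by (simp add: at_within_open[OF _ open_ball])
    have x0b: "x0 \<in> ball x0 \<rho>" using \<rho> by simp
    have ap: "blinfun_apply (integral (cbox 0 1) (B x0)) h = integral (cbox 0 1) (\<lambda>t. D (x0 + e t *s v) h / e t)" for h
    proof -
      have "continuous_on (cbox 0 1) (B x0)"
      proof (rule continuous_on_blinfun_componentwise)
        fix b :: "complex^'a"
        show "continuous_on (cbox 0 1) (\<lambda>t. blinfun_apply (B x0 t) b)"
          unfolding B[OF x0b]
          by (intro continuous_on_divide continuous_on_compose2[OF cD] ce continuous_intros
              continuous_on_compose2[OF linear_continuous_on[OF bounded_linear_vector_scalar_mult_left]])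
             (use e inE[OF x0b] in auto)
      qed
      then have "B x0 integrable_on cbox 0 1" by (rule integrable_continuous)
      then show ?thesis by (subst blinfun_apply_integral) (simp_all add: B[OF x0b])
    qed
    \<comment> \<open>The derivative under the integral is complex linear for each t, and so is its
      mean.\<close>
    have "blinfun_apply (integral (cbox 0 1) (B x0)) (c *s h) = c * blinfun_apply (integral (cbox 0 1) (B x0)) h" for c h
      unfolding ap by (simp add: D(2)[OF inE[OF x0b]] flip: integral_mult_right times_divide_eq_right)
    with d show "\<exists>L. ((\<lambda>x. D x v) has_derivative L) (at x0) \<and> (\<forall>c h. L (c *s h) = c * L h)" by blast
  qed
  then show ?thesis
    unfolding holo_on_sm_def
    by (metis (no_types, lifting) D_eq U has_derivative_transform_within_open)
qed

section \<open>The Euler operator and star-shaped Hartogs domains\<close>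

lemma holo_on_sm_add:
  assumes "holo_on_sm sm U f" "holo_on_sm sm U g"
  shows "holo_on_sm sm U (\<lambda>x. f x + g x)"
  unfolding holo_on_sm_def
proof
  fix x assume "x \<in> U"
  with assms obtain L M where
    "(f has_derivative L) (at x)" "\<forall>c v. L (sm c v) = c * L v"
    "(g has_derivative M) (at x)" "\<forall>c v. M (sm c v) = c * M v"
    unfolding holo_on_sm_def by meson
  then show "\<exists>L. ((\<lambda>x. f x + g x) has_derivative L) (at x) \<and> (\<forall>c v. L (sm c v) = c * L v)"
    by (intro exI[of _ "\<lambda>h. L h + M h"] conjI has_derivative_add)
       (auto simp: algebra_simps)
qed

lemma holo_on_sm_sum:
  assumes "\<And>i. i \<in> I \<Longrightarrow> holo_on_sm sm U (f i)"
  shows "holo_on_sm sm U (\<lambda>x. \<Sum>i\<in>I. f i x)"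
  using assms
  by (induction I rule: infinite_finite_induct) (auto intro!: holo_on_sm_const holo_on_sm_add)

lemma holo_on_sm_nth: "holo_on_sm (*s) U (\<lambda>x :: complex^'a::finite. x $ i)"
  unfolding holo_on_sm_def
  by (auto intro!: exI[of _ "\<lambda>h. h $ i"] bounded_linear_imp_has_derivative bounded_linear_vec_nth)

lemma holo_on_sm_cong:
  assumes "open U" "\<And>x. x \<in> U \<Longrightarrow> f x = g x" "holo_on_sm sm U f"
  shows "holo_on_sm sm U g"
  using assms unfolding holo_on_sm_def
  by (metis (no_types, lifting) has_derivative_transform_within_open)

lemma vec_upd_eq: "(\<chi> i. if i = j then t else x $ i) = x + (t - x $ j) *s axis j (1::complex)"
  by (simp add: vec_eq_iff axis_def)

lemma pderiv_c_eq:
  fixes f :: "complex^'a::finite \<Rightarrow> complex"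
  assumes L: "(f has_derivative L) (at x)" "\<And>c v. L (c *s v) = c * L v"
  shows "pderiv_c j f x = L (axis j 1)"
proof -
  have "((\<lambda>t. x + (t - x $ j) *s axis j 1) has_derivative (\<lambda>h. h *s axis j 1)) (at (x $ j))"
    using has_derivative_add[OF has_derivative_const bounded_linear.has_derivative[OF
       bounded_linear_vector_scalar_mult_left[of "axis j 1"] has_derivative_diff[OF has_derivative_ident has_derivative_const]]]
    by simp
  moreover have "(f has_derivative L) (at (x + (x $ j - x $ j) *s axis j 1))" using L(1) by simp
  ultimately have "((\<lambda>t. f (x + (t - x $ j) *s axis j 1)) has_derivative (\<lambda>h. L (h *s axis j 1))) (at (x $ j))"
    by (rule has_derivative_compose)
  then have "((\<lambda>t. f (x + (t - x $ j) *s axis j 1)) has_field_derivative L (axis j 1)) (at (x $ j))"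
    unfolding has_field_derivative_def L(2) by (simp add: mult.commute[of _ "L (axis j 1)"])
  then show ?thesis
    unfolding pderiv_c_def vec_upd_eq by (rule DERIV_imp_deriv)
qed

lemma complex_linear_expansion:
  fixes L :: "complex^'a::finite \<Rightarrow> complex"
  assumes "linear L" "\<And>c v. L (c *s v) = c * L v"
  shows "L v = (\<Sum>i\<in>UNIV. v $ i * L (axis i 1))"
proof -
  have "L v = L (\<Sum>i\<in>UNIV. v $ i *s axis i 1)" by (simp add: basis_expansion)
  also have "\<dots> = (\<Sum>i\<in>UNIV. v $ i * L (axis i 1))" by (simp add: linear_sum[OF assms(1)] assms(2))
  finally show ?thesis .
qed

text \<open>The vector with entries \<open>\<gamma> i * x $ i\<close> is the velocity at x of the
  scaling flow, so the operator is a multiple of f plus a single directional derivative along the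
  flow.\<close>

lemma euler_op_eq:
  fixes f :: "complex^'a::finite \<Rightarrow> complex"
  assumes L: "(f has_derivative L) (at x)" "\<And>c v. L (c *s v) = c * L v"
  shows "euler_op Z \<gamma> f x = complex_of_real (\<Sum>j\<in>Z. \<gamma> j) * f x + L (\<chi> i. if i \<in> Z then complex_of_real (\<gamma> i) * x $ i else 0)"
proof -
  have "L (\<chi> i. if i \<in> Z then complex_of_real (\<gamma> i) * x $ i else 0)
      = (\<Sum>i\<in>UNIV. if i \<in> Z then complex_of_real (\<gamma> i) * x $ i * L (axis i 1) else 0)"
    by (subst complex_linear_expansion[OF has_derivative_linear[OF L(1)] L(2)])
       (intro sum.cong, auto)
  also have "\<dots> = (\<Sum>i\<in>Z. complex_of_real (\<gamma> i) * x $ i * L (axis i 1))"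
    by (simp add: sum.If_cases)
  finally show ?thesis
    unfolding euler_op_def pderiv_c_eq[OF L]
    by (simp add: sum.distrib distrib_left sum_distrib_right mult.assoc)
qed

lemma holo_on_euler_op:
  fixes f :: "complex^'a::finite \<Rightarrow> complex"
  assumes U: "open U" and f: "holo_on_sm (*s) U f"
  shows "holo_on_sm (*s) U (euler_op Z \<gamma> f)"
proof (rule holo_on_sm_cong[OF U])
  show "holo_on_sm (*s) U (\<lambda>x. \<Sum>j\<in>Z. complex_of_real (\<gamma> j) * (f x + x $ j * frechet_derivative f (at x) (axis j 1)))"
    by (intro holo_on_sm_sum holo_on_sm_mult holo_on_sm_add holo_on_sm_const holo_on_sm_nth f
          holo_on_sm_directional_derivative U)
next
  fix x assume "x \<in> U"
  with f obtain L where L: "(f has_derivative L) (at x)" "\<And>c v. L (c *s v) = c * L v"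
    unfolding holo_on_sm_def by blast
  show "(\<Sum>j\<in>Z. complex_of_real (\<gamma> j) * (f x + x $ j * frechet_derivative f (at x) (axis j 1))) = euler_op Z \<gamma> f x"
    unfolding euler_op_def pderiv_c_eq[OF L] frechet_derivative_at[OF L(1), symmetric] ..
qed

lemma holo_on_euler_op_iter:
  fixes f :: "complex^'a::finite \<Rightarrow> complex"
  assumes U: "open U" and f: "holo_on_sm (*s) U f"
  shows "holo_on_sm (*s) U ((euler_op Z \<gamma> ^^ k) f)"
  by (induction k) (simp_all add: f holo_on_euler_op[OF U])

text \<open>Kernels are unconstrained off their domain, so formulas for them hold on open sets only;
  the operator sees just the germ of its argument.\<close>

lemma euler_op_cong:
  fixes f g :: "complex^'a::finite \<Rightarrow> complex"
  assumes U: "open U" and eq: "\<And>x. x \<in> U \<Longrightarrow> f x = g x" and x: "x \<in> U"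
  shows "euler_op Z \<gamma> f x = euler_op Z \<gamma> g x"
proof -
  have "pderiv_c j f x = pderiv_c j g x" for j
    unfolding pderiv_c_def vec_upd_eq
  proof (rule deriv_cong_ev)
    have "((\<lambda>t. x + (t - x $ j) *s axis j 1) \<longlongrightarrow> x + (x $ j - x $ j) *s axis j 1) (nhds (x $ j))"
      by (intro tendsto_intros bounded_linear.tendsto[OF bounded_linear_vector_scalar_mult_left]) (auto simp: filterlim_ident)
    then have "\<forall>\<^sub>F t in nhds (x $ j). x + (t - x $ j) *s axis j 1 \<in> U"
      by (rule topological_tendstoD) (use U x in auto)
    then show "\<forall>\<^sub>F t in nhds (x $ j). f (x + (t - x $ j) *s axis j 1) = g (x + (t - x $ j) *s axis j 1)"
      by (rule eventually_mono) (rule eq)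
  qed simp
  then show ?thesis using eq[OF x] by (simp add: euler_op_def)
qed

lemma euler_op_iter_cong:
  fixes f g :: "complex^'a::finite \<Rightarrow> complex"
  assumes U: "open U" and eq: "\<And>x. x \<in> U \<Longrightarrow> f x = g x" and x: "x \<in> U"
  shows "(euler_op Z \<gamma> ^^ k) f x = (euler_op Z \<gamma> ^^ k) g x"
  using x
proof (induction k arbitrary: x)
  case (Suc k)
  then show ?case using euler_op_cong[OF U Suc.IH] by simp
qed (simp add: eq)

text \<open>The velocity field of the flow is linear and diagonal, so a diagonal scaling maps it to
  itself and commutes with the operator.\<close>

lemma euler_op_dscale_cmult:
  fixes f :: "complex^'a::finite \<Rightarrow> complex"
  assumes f: "holo_on_sm (*s) U f" and x: "dscale c x \<in> U"
  shows "euler_op Z \<gamma> (\<lambda>x. b * f (dscale c x)) x = b * euler_op Z \<gamma> f (dscale c x)"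
proof -
  from f x obtain L where L: "(f has_derivative L) (at (dscale c x))" "\<And>c v. L (c *s v) = c * L v"
    unfolding holo_on_sm_def by blast
  have sm: "dscale c (a *s v) = a *s dscale c v" for a v by (simp add: vec_eq_iff)
  have "((\<lambda>x. b * f (dscale c x)) has_derivative (\<lambda>h. b * L (dscale c h))) (at x)"
    by (intro has_derivative_mult_right
          has_derivative_compose[OF bounded_linear_imp_has_derivative[OF bounded_linear_dscale] L(1)])
  then have e1: "euler_op Z \<gamma> (\<lambda>x. b * f (dscale c x)) x = complex_of_real (\<Sum>j\<in>Z. \<gamma> j) * (b * f (dscale c x))
      + b * L (dscale c (\<chi> i. if i \<in> Z then complex_of_real (\<gamma> i) * x $ i else 0))"
    by (rule euler_op_eq) (simp add: sm L(2))
  have e2: "dscale c (\<chi> i. if i \<in> Z then complex_of_real (\<gamma> i) * x $ i else 0)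
      = (\<chi> i. if i \<in> Z then complex_of_real (\<gamma> i) * dscale c x $ i else 0)"
    by (simp add: vec_eq_iff)
  show ?thesis unfolding e1 e2 euler_op_eq[OF L] by (simp add: distrib_left)
qed

lemma euler_op_iter_dscale_cmult:
  fixes f :: "complex^'a::finite \<Rightarrow> complex"
  assumes U: "open U" and f: "holo_on_sm (*s) U f" and x: "dscale c x \<in> U"
  shows "(euler_op Z \<gamma> ^^ k) (\<lambda>x. b * f (dscale c x)) x = b * (euler_op Z \<gamma> ^^ k) f (dscale c x)"
  using x
proof (induction k arbitrary: x)
  case (Suc k)
  have "continuous_on UNIV (dscale c)" by (intro continuous_intros)
  \<comment> \<open>The induction hypothesis is an identity on the preimage of U only; this set is
    open, as \<open>euler_op_cong\<close> requires.\<close>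
  then have o: "open (dscale c -` U)" 
    by (intro continuous_open_vimage U) (simp add: continuous_on_eq_continuous_at)
  have "(euler_op Z \<gamma> ^^ Suc k) (\<lambda>x. b * f (dscale c x)) x
      = euler_op Z \<gamma> (\<lambda>x. b * (euler_op Z \<gamma> ^^ k) f (dscale c x)) x"
    using Suc euler_op_cong[OF o, of "(euler_op Z \<gamma> ^^ k) (\<lambda>x. b * f (dscale c x))" "\<lambda>x. b * (euler_op Z \<gamma> ^^ k) f (dscale c x)" x]
    by simp
  also have "\<dots> = b * (euler_op Z \<gamma> ^^ Suc k) f (dscale c x)"
    using euler_op_dscale_cmult[OF holo_on_euler_op_iter[OF U f] Suc.prems] by simp
  finally show ?case .
qed simp

text \<open>Time is complex so that \<open>g_map\<close> (real times), \<open>l_map\<close> and the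
  fibre parts of the automorphisms all belong to one commutative group.\<close>

definition zexp :: "'a set \<Rightarrow> ('a \<Rightarrow> real) \<Rightarrow> complex \<Rightarrow> 'a \<Rightarrow> complex" where
  "zexp Z \<gamma> \<tau> i = (if i \<in> Z then exp (complex_of_real (\<gamma> i) * \<tau>) else 1)"

lemma zexp_nonzero: "zexp Z \<gamma> \<tau> i \<noteq> 0"
  by (simp add: zexp_def)

lemma zexp_0 [simp]: "dscale (zexp Z \<gamma> 0) x = x"
  by (simp add: zexp_def vec_eq_iff)

lemma dscale_zexp_add: "dscale (zexp Z \<gamma> a) (dscale (zexp Z \<gamma> b) x) = dscale (zexp Z \<gamma> (a + b)) x"
  by (simp add: zexp_def vec_eq_iff exp_add distrib_left)

lemma prod_zexp: "(\<Prod>i\<in>UNIV. zexp Z \<gamma> \<tau> i) = exp (complex_of_real (\<Sum>j\<in>Z. \<gamma> j) * \<tau>)"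
  for Z :: "'a::finite set"
proof -
  have "(\<Prod>i\<in>UNIV. zexp Z \<gamma> \<tau> i) = (\<Prod>i\<in>Z. exp (complex_of_real (\<gamma> i) * \<tau>))"
    unfolding zexp_def by (simp add: prod.If_cases)
  then show ?thesis by (simp add: exp_sum sum_distrib_right)
qed

lemma prod_norm_zexp: "(\<Prod>i\<in>UNIV. (cmod (zexp Z \<gamma> \<tau> i))\<^sup>2) = (cmod (exp (complex_of_real (\<Sum>j\<in>Z. \<gamma> j) * \<tau>)))\<^sup>2"
  for Z :: "'a::finite set"
  unfolding prod_zexp[symmetric] by (simp add: prod_power_distrib prod_norm[symmetric])

lemma has_derivative_vecI:
  fixes f :: "'v::real_normed_vector \<Rightarrow> 'a::finite \<Rightarrow> complex"
  assumes "\<And>i. ((\<lambda>p. f p i) has_derivative (\<lambda>h. f' h i)) (at p within S)"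
  shows "((\<lambda>p. \<chi> i. f p i) has_derivative (\<lambda>h. \<chi> i. f' h i)) (at p within S)"
proof (rule has_derivative_componentwise_within[THEN iffD2], rule ballI)
  fix b :: "complex^'a" assume "b \<in> Basis"
  then obtain i u where b: "b = axis i u" by (auto simp: Basis_vec_def)
  show "((\<lambda>p. (\<chi> i. f p i) \<bullet> b) has_derivative (\<lambda>h. (\<chi> i. f' h i) \<bullet> b)) (at p within S)"
    unfolding b inner_axis vec_lambda_beta by (rule has_derivative_inner_left[OF assms])
qed

text \<open>The exponential contributes the zeroth-order part of \<open>euler_op_eq\<close> and the
  flow contributes the directional derivative; both carry a minus sign because time runs
  backwards.\<close>

lemma euler_flow_has_vector_derivative:
  fixes f :: "complex^'a::finite \<Rightarrow> complex"
  assumes f: "holo_on_sm (*s) U f" and s: "dscale (zexp Z \<gamma> (- of_real s)) x \<in> U"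
  defines "c \<equiv> \<Sum>j\<in>Z. \<gamma> j"
  shows "((\<lambda>s. exp (- c * s) *\<^sub>R f (dscale (zexp Z \<gamma> (- of_real s)) x)) has_vector_derivative
     - (exp (- c * s) *\<^sub>R euler_op Z \<gamma> f (dscale (zexp Z \<gamma> (- of_real s)) x))) (at s)"
proof -
  define y where "y = dscale (zexp Z \<gamma> (- of_real s)) x"
  define v where "v = (\<chi> i. if i \<in> Z then complex_of_real (\<gamma> i) * y $ i else 0)"
  from f s obtain L where L: "(f has_derivative L) (at y)" "\<And>c v. L (c *s v) = c * L v"
    unfolding holo_on_sm_def y_def by blast
  have "((\<lambda>s. \<chi> i. zexp Z \<gamma> (- of_real s) i * x $ i) has_derivative (\<lambda>h. \<chi> i. (- of_real h * v $ i))) (at s)"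
  proof (rule has_derivative_vecI)
    fix i
    show "((\<lambda>s. zexp Z \<gamma> (- of_real s) i * x $ i) has_derivative (\<lambda>h. - of_real h * v $ i)) (at s)"
    proof (cases "i \<in> Z")
      case True
      have "((\<lambda>s. exp (complex_of_real (\<gamma> i) * - of_real s) * x $ i) has_derivative
        (\<lambda>h. exp (complex_of_real (\<gamma> i) * - of_real s) * (complex_of_real (\<gamma> i) * - of_real h) * x $ i)) (at s)"
      proof -
        have 1: "((\<lambda>s. complex_of_real (\<gamma> i) * - of_real s) has_derivative (\<lambda>h. complex_of_real (\<gamma> i) * - of_real h)) (at s)"
          by (intro has_derivative_mult_right has_derivative_minus has_derivative_of_real has_derivative_ident)
        have 2: "(exp has_derivative (\<lambda>h. exp z * h)) (at z)" for z :: complex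
          using DERIV_exp[of z] by (simp add: has_field_derivative_def)
        show ?thesis by (rule has_derivative_mult_left[OF has_derivative_compose[OF 1 2]])
      qed
      then show ?thesis using True by (simp add: zexp_def v_def y_def mult_ac)
    qed (simp add: zexp_def v_def)
  qed
  then have d: "((\<lambda>s. dscale (zexp Z \<gamma> (- of_real s)) x) has_derivative (\<lambda>h. - of_real h *s v)) (at s)"
    unfolding dscale_def by (simp add: vector_scalar_mult_def)
  from has_derivative_compose[OF d L(1)[unfolded y_def], unfolded L(2)]
  have d1: "((\<lambda>s. f (dscale (zexp Z \<gamma> (- of_real s)) x)) has_vector_derivative - L v) (at s)"
    unfolding has_vector_derivative_def by (simp add: scaleR_conv_of_real)
  have d2: "((\<lambda>s. exp (- c * s)) has_real_derivative (- c * exp (- c * s))) (at s)"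
    by (auto intro!: derivative_eq_intros)
  have e: "euler_op Z \<gamma> f y = complex_of_real c * f y + L v"
    unfolding euler_op_eq[OF L] v_def c_def ..
  show ?thesis
    using has_vector_derivative_scaleR[OF d2 d1]
    unfolding y_def[symmetric] e by (simp add: scaleR_conv_of_real algebra_simps)
qed

lemma star_hartogs_dscale:
  assumes "star_hartogs Z \<Omega>" "x \<in> \<Omega>" "\<And>i. i \<in> Z \<Longrightarrow> cmod (c i) \<le> 1" "\<And>i. i \<notin> Z \<Longrightarrow> c i = 1"
  shows "dscale c x \<in> \<Omega>"
proof -
  have "(\<chi> i. if i \<in> Z then c i * x $ i else x $ i) \<in> \<Omega>"
    using assms unfolding star_hartogs_def by blast
  also have "(\<chi> i. if i \<in> Z then c i * x $ i else x $ i) = dscale c x"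
    using assms(4) by (simp add: vec_eq_iff)
  finally show ?thesis .
qed

text \<open>Only the real part of the time matters: lowering it multiplies each z-coordinate by a
  number of modulus at most 1.\<close>

lemma star_hartogs_zexp:
  assumes "star_hartogs Z \<Omega>" "\<forall>j\<in>Z. \<gamma> j > 0" "dscale (zexp Z \<gamma> a) x \<in> \<Omega>" "Re b \<le> Re a"
  shows "dscale (zexp Z \<gamma> b) x \<in> \<Omega>"
proof -
  have "dscale (zexp Z \<gamma> (b - a)) (dscale (zexp Z \<gamma> a) x) \<in> \<Omega>"
    using assms by (intro star_hartogs_dscale[OF assms(1,3)])
      (auto simp: zexp_def mult_le_0_iff less_imp_le)
  then show ?thesis by (simp add: dscale_zexp_add)
qed

section \<open>Bergman kernels under diagonal scalings\<close>

lemma bergman_kernel_dscale: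
  fixes c :: "'a::finite \<Rightarrow> complex"
  assumes U: "open U" "open U'" and c: "\<And>i. c i \<noteq> 0" and cU: "\<And>x. dscale c x \<in> U' \<longleftrightarrow> x \<in> U"
    and K: "is_bergman_kernel_sm (*s) U' K"
  defines "b \<equiv> \<Prod>i\<in>UNIV. c i"
  shows "is_bergman_kernel_sm (*s) U (\<lambda>x y. b * cnj b * K (dscale c x) (dscale c y))"
proof (rule bergman_kernel_transform[OF U cU])
  have h: "holo_map_on (*s) (*s) X (dscale a)" for X and a :: "'a \<Rightarrow> complex"
    unfolding holo_map_on_def
    by (intro ballI exI[of _ "dscale a"] conjI bounded_linear_imp_has_derivative[OF bounded_linear_dscale])
       (simp add: vec_eq_iff)
  show "holo_map_on (*s) (*s) U (dscale c)" "holo_map_on (*s) (*s) U' (dscale (\<lambda>i. inverse (c i)))"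
    by (fact h)+
  show "dscale (\<lambda>i. inverse (c i)) (dscale c x) = x" "dscale c (dscale (\<lambda>i. inverse (c i)) x) = x" for x
    using c by (simp_all add: dscale_dscale)
  show "holo_on_sm (*s) U (\<lambda>_. b)" by (rule holo_on_sm_const)
  show "b \<noteq> 0" using c by (simp add: b_def)
  have "(\<Prod>i\<in>UNIV. (cmod (c i))\<^sup>2) = (cmod b)\<^sup>2"
    by (simp add: b_def prod_power_distrib prod_norm[symmetric])
  then show "distr (density lborel (\<lambda>x. ennreal ((cmod b)\<^sup>2))) borel (dscale c) = lborel"
    using distr_density_dscale[of c, OF c] by simp
qed (simp_all add: K)

text \<open>Rotations of the z-coordinates preserve \<Omega>, and their Jacobian has modulus 1, so
  it cancels from the transformation law.\<close>

lemma bergman_kernel_unimodular: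
  fixes c :: "'a::finite \<Rightarrow> complex"
  assumes \<Omega>: "open \<Omega>" and st: "star_hartogs Z \<Omega>" and K: "is_bergman_kernel_sm (*s) \<Omega> K"
    and c: "\<And>i. i \<in> Z \<Longrightarrow> cmod (c i) = 1" "\<And>i. i \<notin> Z \<Longrightarrow> c i = 1" and x: "x \<in> \<Omega>" and y: "y \<in> \<Omega>"
  shows "K (dscale c x) (dscale c y) = K x y"
proof -
  have c1: "cmod (c i) = 1" for i using c by (cases "i \<in> Z") auto
  then have c0: "c i \<noteq> 0" for i by (metis norm_zero zero_neq_one)
  have cU: "dscale c x \<in> \<Omega> \<longleftrightarrow> x \<in> \<Omega>" for x
  proof
    assume a: "dscale c x \<in> \<Omega>"
    have "dscale (\<lambda>i. inverse (c i)) (dscale c x) \<in> \<Omega>"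
      by (rule star_hartogs_dscale[OF st a]) (use c in \<open>auto simp: norm_inverse\<close>)
    then show "x \<in> \<Omega>" using c0 by (simp add: dscale_dscale)
  next
    assume "x \<in> \<Omega>" then show "dscale c x \<in> \<Omega>" using c by (intro star_hartogs_dscale[OF st]) auto
  qed
  have "cmod (\<Prod>i\<in>UNIV. c i) = 1" by (simp add: prod_norm[symmetric] c1)
  then have "(\<Prod>i\<in>UNIV. c i) * cnj (\<Prod>i\<in>UNIV. c i) = 1"
    using complex_norm_square[of "\<Prod>i\<in>UNIV. c i"] by simp
  then have "is_bergman_kernel_sm (*s) \<Omega> (\<lambda>x y. K (dscale c x) (dscale c y))"
    using bergman_kernel_dscale[OF \<Omega> \<Omega> c0 cU K] by simp
  from bergman_kernel_unique[OF this K x y] show ?thesis .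
qed

text \<open>For unimodular \<open>c\<close> this is invariance under rotations. Both sides are holomorphic in each
  \<open>c i\<close>, so the identity extends from the torus to the closed polydisc one coordinate at a time.\<close>

lemma bergman_kernel_contraction:
  fixes c :: "'a::finite \<Rightarrow> complex"
  assumes \<Omega>: "open \<Omega>" and st: "star_hartogs Z \<Omega>" and K: "is_bergman_kernel_sm (*s) \<Omega> K"
    and c: "\<And>i. i \<in> Z \<Longrightarrow> cmod (c i) \<le> 1" "\<And>i. i \<notin> Z \<Longrightarrow> c i = 1" and x: "x \<in> \<Omega>" and y: "y \<in> \<Omega>"
  shows "K (dscale c x) y = K x (dscale (\<lambda>i. cnj (c i)) y)"
proof -
  \<comment> \<open>F lists the coordinates that may leave the unit circle: F empty is the rotation
    case, F = Z the claim.\<close>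
  have "K (dscale c x) y = K x (dscale (\<lambda>i. cnj (c i)) y)"
    if "F \<subseteq> Z" "\<And>i. i \<in> Z \<Longrightarrow> cmod (c i) \<le> 1" "\<And>i. i \<notin> Z \<Longrightarrow> c i = 1" "\<And>i. i \<notin> F \<Longrightarrow> cmod (c i) = 1" for F c
    using finite[of F] that
  proof (induction F arbitrary: c rule: finite_induct)
    case empty
    have "c i * cnj (c i) = 1" for i
      using empty(4)[of i] complex_norm_square[of "c i"] by simp
    then have "y = dscale c (dscale (\<lambda>i. cnj (c i)) y)" by (simp add: dscale_dscale)
    moreover have "dscale (\<lambda>i. cnj (c i)) y \<in> \<Omega>"
      using empty by (intro star_hartogs_dscale[OF st y]) auto
    ultimately show ?case
      using bergman_kernel_unimodular[OF \<Omega> st K, of c x "dscale (\<lambda>i. cnj (c i)) y"] empty x by simp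
  next
    case (insert j F)
    define f where "f l = K (dscale (c(j := l)) x) y" for l
    \<comment> \<open>The kernel is antiholomorphic in its second argument. By Hermitian symmetry
      the right-hand side, as a function of the j-th entry l, is \<open>cnj (h (cnj l))\<close>,
      which is holomorphic.\<close>
    define h where "h m = K (dscale ((\<lambda>i. cnj (c i))(j := m)) y) x" for m
    have line: "dscale (a(j := l)) z = dscale (a(j := 0)) z + l *s axis j (z $ j)" for a z and l :: complex
      by (simp add: vec_eq_iff axis_def)
    have kx: "holo_on_sm (*s) \<Omega> (\<lambda>u. K u x)" and ky: "holo_on_sm (*s) \<Omega> (\<lambda>u. K u y)"
      using bergman_kernel_in_space[OF K] x y by (auto simp: bergman_space_sm_def)
    note bl = bounded_linear_vector_scalar_mult_left
    define W1 where "W1 = {l. dscale (c(j := 0)) x + l *s axis j (x $ j) \<in> \<Omega>}"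
    define W2 where "W2 = {l. dscale ((\<lambda>i. cnj (c i))(j := 0)) y + l *s axis j (y $ j) \<in> \<Omega>}"
    have oW: "open W1" "open W2" unfolding W1_def W2_def by (rule open_line_vimage[OF \<Omega> bl])+
    have f: "f holomorphic_on W1"
    proof -
      have "f = (\<lambda>l. K (dscale (c(j := 0)) x + l *s axis j (x $ j)) y)"
        unfolding f_def by (rule ext, rule arg_cong[where f = "\<lambda>u. K u y"], rule line)
      then show ?thesis unfolding W1_def using holo_on_sm_line[OF ky bl] by simp
    qed
    have h: "h holomorphic_on W2"
    proof -
      have "h = (\<lambda>l. K (dscale ((\<lambda>i. cnj (c i))(j := 0)) y + l *s axis j (y $ j)) x)"
        unfolding h_def by (rule ext, rule arg_cong[where f = "\<lambda>u. K u x"], rule line)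
      then show ?thesis unfolding W2_def using holo_on_sm_line[OF kx bl] by simp
    qed
    have W2c: "cnj ` (cnj -` W2) = W2"
      by (auto simp: image_iff) (metis complex_cnj_cnj)
    have oW2: "open (cnj -` W2)"
      by (intro continuous_open_vimage oW) (simp add: continuous_cnj)
    have g: "(cnj \<circ> h \<circ> cnj) holomorphic_on (cnj -` W2)"
      by (rule holomorphic_on_compose_cnj_cnj) (unfold W2c, fact h, fact oW2)
    have j: "j \<in> Z" using insert by auto
    have inW: "l \<in> W1" "l \<in> cnj -` W2" if "cmod l \<le> 1" for l
    proof -
      show "l \<in> W1" unfolding W1_def mem_Collect_eq line[symmetric]
        using insert that j by (intro star_hartogs_dscale[OF st x]) auto
      show "l \<in> cnj -` W2" unfolding W2_def vimage_Collect_eq mem_Collect_eq line[symmetric]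
        using insert that j by (intro star_hartogs_dscale[OF st y]) auto
    qed
    have fg: "f l = (cnj \<circ> h \<circ> cnj) l" if l: "cmod l = 1" for l
    proof -
      have "f l = K x (dscale (\<lambda>i. cnj ((c(j := l)) i)) y)"
        unfolding f_def using insert l j by (intro insert.IH) auto
      also have "(\<lambda>i. cnj ((c(j := l)) i)) = (\<lambda>i. cnj (c i))(j := cnj l)" by auto
      also have "K x (dscale ((\<lambda>i. cnj (c i))(j := cnj l)) y) = cnj (h (cnj l))"
        unfolding h_def using inW(2)[of l] l x by (intro bergman_kernel_hermitian[OF K K])
          (auto simp: W2_def line[of "\<lambda>i. cnj (c i)" "cnj l"])
      finally show ?thesis by simp
    qed
    have "f (c j) = (cnj \<circ> h \<circ> cnj) (c j)"
    proof (rule holomorphic_eq_on_cball[where W = "W1 \<inter> cnj -` W2" and f = f and g = "cnj \<circ> h \<circ> cnj"])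
      show "f holomorphic_on W1 \<inter> cnj -` W2" "(cnj \<circ> h \<circ> cnj) holomorphic_on W1 \<inter> cnj -` W2"
        using f g holomorphic_on_subset by blast+
      show "open (W1 \<inter> cnj -` W2)" using oW oW2 by auto
      show "cball 0 1 \<subseteq> W1 \<inter> cnj -` W2" using inW by auto
      show "cmod (c j) \<le> 1" using insert j by auto
    qed (rule fg)
    also have "(cnj \<circ> h \<circ> cnj) (c j) = K x (dscale (\<lambda>i. cnj (c i)) y)"
    proof -
      have "(\<lambda>i. cnj (c i))(j := cnj (c j)) = (\<lambda>i. cnj (c i))" by auto
      moreover have "dscale (\<lambda>i. cnj (c i)) y \<in> \<Omega>"
        using insert by (intro star_hartogs_dscale[OF st y]) auto
      ultimately show ?thesis
        unfolding h_def o_def using bergman_kernel_hermitian[OF K K x, of "dscale (\<lambda>i. cnj (c i)) y"] by simp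
    qed
    also have "f (c j) = K (dscale c x) y" by (simp add: f_def)
    finally show ?case .
  qed
  from this[of Z c] c show ?thesis by auto
qed

section \<open>Radial integrals and iterated derivatives\<close>

text \<open>A ball of squared radius r in real dimension 2k has volume pi^k r^k / k!. The density is
  the derivative of this volume in r, so both measures agree on half-lines, and these generate the
  Borel sets.\<close>

lemma distr_norm_square_lborel:
  defines "k \<equiv> CARD('k::finite)"
  shows "distr lborel borel (\<lambda>w::complex^'k. (norm w)\<^sup>2)
    = density lborel (\<lambda>t. ennreal (pi ^ k * t ^ (k - 1) / fact (k - 1)) * indicator {0..} t)" (is "?M = ?N")
proof (rule measure_eqI_generator_eq[where E = "range (\<lambda>r::real. {..r})" and \<Omega> = UNIV and A = "\<lambda>i::nat. {..real i}"])
  have k: "k > 0" by (simp add: k_def)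
  have Me: "emeasure ?M {..r} = (if r < 0 then 0 else ennreal (pi ^ k / fact k * r ^ k))" for r
  proof -
    have "emeasure ?M {..r} = emeasure lborel {w::complex^'k. (norm w)\<^sup>2 \<le> r}"
      by (subst emeasure_distr) (auto simp: vimage_def)
    also have "\<dots> = (if r < 0 then 0 else ennreal (pi ^ k / fact k * r ^ k))"
    proof (cases "r < 0")
      case True
      then have "{w::complex^'k. (norm w)\<^sup>2 \<le> r} = {}"
        by (auto simp: not_le intro: less_le_trans[OF _ zero_le_power2])
      then show ?thesis using True by simp
    next
      case False
      then have eq: "{w::complex^'k. (norm w)\<^sup>2 \<le> r} = cball 0 (sqrt r)"
      proof -
        have "(norm w)\<^sup>2 \<le> r \<longleftrightarrow> norm w \<le> sqrt r" for w :: "complex^'k"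
          using False real_sqrt_le_iff[of "(norm w)\<^sup>2" r] by simp
        then show ?thesis unfolding cball_def dist_0_norm by (simp only:)
      qed
      have dim: "DIM(complex^'k) = 2 * k" by (simp add: k_def)
      have "sqrt r ^ (2 * k) = r ^ k" using False by (simp add: power_mult)
      then show ?thesis
        unfolding eq using False emeasure_cball[of "sqrt r" "0::complex^'k"] unit_ball_vol_even[of k]
        unfolding dim by simp
    qed
    finally show ?thesis .
  qed
  have Ne: "emeasure ?N {..r} = (if r < 0 then 0 else ennreal (pi ^ k / fact k * r ^ k))" for r
  proof -
    have "emeasure ?N {..r} = (\<integral>\<^sup>+t. ennreal (pi ^ k * t ^ (k - 1) / fact (k - 1)) * indicator {0..r} t \<partial>lborel)"
      by (subst emeasure_density) (auto intro!: nn_integral_cong split: split_indicator)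
    also have "\<dots> = (if r < 0 then 0 else ennreal (pi ^ k / fact k * r ^ k))"
    proof (cases "r < 0")
      case False
      have d: "((\<lambda>t. pi ^ k / fact k * t ^ k) has_real_derivative (pi ^ k * t ^ (k - 1) / fact (k - 1))) (at t)" for t
      proof -
        have "((\<lambda>t. pi ^ k / fact k * t ^ k) has_real_derivative pi ^ k / fact k * (real k * t ^ (k - 1))) (at t)"
          by (auto intro!: derivative_eq_intros)
        moreover have "fact k = real k * fact (k - 1)" using k by (rule fact_reduce)
        ultimately show ?thesis using k by simp
      qed
      have "(\<integral>\<^sup>+t. ennreal (pi ^ k * t ^ (k - 1) / fact (k - 1)) * indicator {0..r} t \<partial>lborel)
        = ennreal (pi ^ k / fact k * r ^ k - pi ^ k / fact k * 0 ^ k)"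
        using False d by (intro nn_integral_FTC_Icc[where F = "\<lambda>t. pi ^ k / fact k * t ^ k"])
          (auto intro: has_field_derivative_at_within)
      then show ?thesis using False k by (simp add: power_0_left)
    qed simp
    finally show ?thesis .
  qed
  show "emeasure ?M X = emeasure ?N X" if "X \<in> range (\<lambda>r::real. {..r})" for X
    using that Me Ne by auto
  show "emeasure ?M {..real i} \<noteq> \<infinity>" for i
    unfolding Me by simp
  show "Int_stable (range (\<lambda>r::real. {..r}))"
    by (auto simp: Int_stable_def intro: exI[of _ "min _ _"])
  show "sets ?M = sigma_sets UNIV (range (\<lambda>r::real. {..r}))" "sets ?N = sigma_sets UNIV (range (\<lambda>r::real. {..r}))"
    by (simp_all add: borel_eq_atMost)
  show "(\<Union>i::nat. {..real i}) = UNIV"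
    by (auto intro: real_arch_simple)
qed auto

text \<open>Up to a constant factor the integrand is the Erlang density, whose total mass is
  1.\<close>

lemma set_integrable_power_exp:
  assumes "c > 0"
  shows "set_integrable lborel {0..} (\<lambda>t::real. t ^ n * exp (- c * t))"
proof -
  interpret prob_space "density lborel (erlang_density n c)"
    using assms by (rule prob_space_erlang_density)
  have "(\<integral>\<^sup>+t. ennreal (erlang_density n c t) \<partial>lborel) = 1"
    using emeasure_space_1 by (simp add: emeasure_density)
  then have "integrable lborel (erlang_density n c)"
    using assms by (intro integrableI_nonneg) (auto simp: erlang_density_nonneg)
  then have "integrable lborel (\<lambda>t. (fact n / c ^ Suc n) * erlang_density n c t)"
    by (rule integrable_mult_right)
  also have "(\<lambda>t. (fact n / c ^ Suc n) * erlang_density n c t) = (\<lambda>t. indicator {0..} t *\<^sub>R (t ^ n * exp (- c * t)))"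
    using assms by (auto simp: erlang_density_def fun_eq_iff indicator_def)
  finally show ?thesis by (simp add: set_integrable_def)
qed

lemma nn_integral_gaussian_finite:
  assumes "c > 0"
  shows "(\<integral>\<^sup>+(w::complex^'k::finite).  ennreal (exp (- c * (norm w)\<^sup>2)) \<partial>lborel) < \<infinity>"
proof -
  define k where "k = CARD('k)"
  have "(\<integral>\<^sup>+(w::complex^'k).  ennreal (exp (- c * (norm w)\<^sup>2)) \<partial>lborel)
      = (\<integral>\<^sup>+t. ennreal (exp (- c * t)) \<partial>distr lborel borel (\<lambda>w::complex^'k. (norm w)\<^sup>2))"
    by (subst nn_integral_distr) simp_all
  also have "\<dots> = (\<integral>\<^sup>+t. ennreal (pi ^ k / fact (k - 1) * (indicator {0..} t *\<^sub>R (t ^ (k - 1) * exp (- c * t)))) \<partial>lborel)"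
    unfolding distr_norm_square_lborel k_def
    by (subst nn_integral_density)
       (auto intro!: nn_integral_cong simp: ennreal_mult''[symmetric] split: split_indicator)
  also have "\<dots> < \<infinity>"
  proof -
    have i: "integrable lborel (\<lambda>t. pi ^ k / fact (k - 1) * (indicator {0..} t *\<^sub>R (t ^ (k - 1) * exp (- c * t))))" (is "integrable _ ?g")
      using set_integrable_power_exp[OF assms, of "k - 1"] unfolding set_integrable_def by (rule integrable_mult_right)
    have "(\<integral>\<^sup>+t. ennreal (?g t) \<partial>lborel) \<le> (\<integral>\<^sup>+t. ennreal (norm (?g t)) \<partial>lborel)"
      by (intro nn_integral_mono ennreal_leI) (simp only: real_norm_def abs_ge_self)
    also have "\<dots> < \<infinity>" using i unfolding integrable_iff_bounded by blast
    finally show ?thesis .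
  qed
  finally show ?thesis .
qed

text \<open>The witness is the tail integral over \<open>{s..}\<close>. Integration keeps the
  exponential rate c and only changes the constant to C / c, so the step can be repeated.\<close>

lemma decaying_antiderivative:
  fixes \<phi> :: "real \<Rightarrow> complex"
  assumes c: "c > 0" and cont: "continuous_on {0..} \<phi>" and bd: "\<And>t. t \<ge> 0 \<Longrightarrow> cmod (\<phi> t) \<le> C * exp (- c * t)"
  shows "\<exists>\<Phi>. continuous_on {0..} \<Phi> \<and> (\<exists>C'. \<forall>t\<ge>0. cmod (\<Phi> t) \<le> C' * exp (- c * t)) \<and>
    (\<forall>s>0. (\<Phi> has_vector_derivative - \<phi> s) (at s))"
proof -
  have gi: "((\<lambda>t. C * exp (- c * t)) has_integral C * (exp (- c * s) / c)) {s..}" for s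
    using has_integral_exp_minus_to_infinity[OF c, of s] by (intro has_integral_mult_right)
  have \<phi>i: "\<phi> integrable_on {s..}" if s: "s \<ge> 0" for s
  proof (rule measurable_bounded_by_integrable_imp_integrable)
    show "(\<lambda>t. C * exp (- c * t)) integrable_on {s..}" using gi by blast
    show "\<phi> \<in> borel_measurable (lebesgue_on {s..})"
      using cont s by (intro continuous_imp_measurable_on_sets_lebesgue) (auto intro: continuous_on_subset)
    show "cmod (\<phi> x) \<le> C * exp (- c * x)" if "x \<in> {s..}" for x using bd that s by auto
  qed simp
  \<comment> \<open>Written as a difference so that the fundamental theorem applies on compact
    intervals; \<open>eq\<close> identifies it with the tail integral.\<close>
  define \<Phi> where "\<Phi> s = integral {0..} \<phi> - integral {0..s} \<phi>" for s
  have eq: "\<Phi> s = integral {s..} \<phi>" if s: "s \<ge> 0" for s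
  proof -
    have "integral ({0..s} \<union> {s..}) \<phi> = integral {0..s} \<phi> + integral {s..} \<phi>"
    proof (rule integral_Un)
      show "\<phi> integrable_on {0..s}"
        using cont by (intro integrable_continuous_interval) (auto intro: continuous_on_subset)
      have "{0..s} \<inter> {s..} = {s}" using s by auto
      then show "negligible ({0..s} \<inter> {s..})" by simp
    qed (rule \<phi>i[OF s])
    moreover have "{0..s} \<union> {s..} = {0..}" using s by auto
    ultimately show ?thesis by (simp add: \<Phi>_def)
  qed
  have bound: "cmod (\<Phi> s) \<le> (C / c) * exp (- c * s)" if s: "s \<ge> 0" for s
  proof -
    have "cmod (integral {s..} \<phi>) \<le> integral {s..} (\<lambda>t. C * exp (- c * t))"
      by (rule integral_norm_bound_integral[OF \<phi>i[OF s]]) (use gi bd s in auto)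
    also have "\<dots> = C * (exp (- c * s) / c)" using gi by (rule integral_unique)
    finally show ?thesis unfolding eq[OF s] by simp
  qed
  have der: "(\<Phi> has_vector_derivative - \<phi> s) (at s within {0..s + 1})" if s: "s \<ge> 0" for s
  proof -
    have "((\<lambda>u. integral {0..u} \<phi>) has_vector_derivative \<phi> s) (at s within {0..s+1})"
      using cont s by (intro integral_has_vector_derivative) (auto intro: continuous_on_subset)
    then show ?thesis
      unfolding \<Phi>_def using has_vector_derivative_diff[OF has_vector_derivative_const] by fastforce
  qed
  \<comment> \<open>At s = 0 the derivative is one-sided, so the two-sided statement is restricted
    to positive s.\<close>
  have der': "(\<Phi> has_vector_derivative - \<phi> s) (at s)" if "s > 0" for s
  proof -
    have "(\<Phi> has_vector_derivative - \<phi> s) (at s within {0<..<s + 1})"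
      using der[of s] that by (rule_tac has_vector_derivative_within_subset) auto
    then show ?thesis using that by (simp add: at_within_open[of s "{0<..<s+1}"])
  qed
  have "continuous_on {0..} \<Phi>"
    unfolding continuous_on_eq_continuous_within
  proof
    fix s :: real assume s: "s \<in> {0..}"
    have "continuous (at s within {0..s+1}) \<Phi>"
      using der[of s] s has_vector_derivative_continuous by auto
    moreover have "at s within {0..s+1} = at s within {0..}"
      using s by (intro at_within_nhd[of s "{s - 1<..<s+1}"]) auto
    ultimately show "continuous (at s within {0..}) \<Phi>" by simp
  qed
  with bound der' show ?thesis by blast
qed

lemma decaying_antiderivatives:
  fixes \<phi> :: "real \<Rightarrow> complex"
  assumes c: "c > 0" and cont: "continuous_on {0..} \<phi>" and bd: "\<And>t. t \<ge> 0 \<Longrightarrow> cmod (\<phi> t) \<le> C * exp (- c * t)"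
  obtains \<Phi> :: "nat \<Rightarrow> real \<Rightarrow> complex" where "\<Phi> 0 = \<phi>" "\<And>j. continuous_on {0..} (\<Phi> j)"
    "\<And>j. \<exists>C. \<forall>t\<ge>0. cmod (\<Phi> j t) \<le> C * exp (- c * t)"
    "\<And>j s. s > 0 \<Longrightarrow> (\<Phi> (Suc j) has_vector_derivative - \<Phi> j s) (at s)"
proof -
  \<comment> \<open>The clause for j = 0 pins the start of the sequence, since dependent choice only
    provides some sequence with the property.\<close>
  define P where "P j f \<longleftrightarrow> continuous_on {0..} f \<and> (\<exists>C. \<forall>t\<ge>0. cmod (f t) \<le> C * exp (- c * t)) \<and> (j = 0 \<longrightarrow> f = \<phi>)"
    for j :: nat and f :: "real \<Rightarrow> complex"
  define Q where "Q j f g \<longleftrightarrow> (\<forall>s>0. (g has_vector_derivative - f s) (at s))"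
    for j :: nat and f g :: "real \<Rightarrow> complex"
  have "\<exists>\<Phi>. \<forall>n. P n (\<Phi> n) \<and> Q n (\<Phi> n) (\<Phi> (Suc n))"
  proof (rule dependent_nat_choice)
    show "\<exists>f. P 0 f" using cont bd by (auto simp: P_def)
    show "\<exists>g. P (Suc n) g \<and> Q n f g" if "P n f" for f n
      using that decaying_antiderivative[OF c, of f] unfolding P_def Q_def by (metis nat.distinct(1))
  qed
  then obtain \<Phi> where "\<And>n. P n (\<Phi> n)" "\<And>n. Q n (\<Phi> n) (\<Phi> (Suc n))" by blast
  then show ?thesis
    by (intro that[of \<Phi>]) (auto simp: P_def Q_def)
qed

text \<open>In the variable t = |w|^2 and with k the dimension, the claim is Cauchy's formula for
  repeated integration: the integral of t^(k-1) / (k-1)! against \<open>\<Phi> 0 (t + s)\<close>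
  over positive t equals \<open>\<Phi> k s\<close>.\<close>

lemma integral_norm_square_antiderivative:
  fixes \<Phi> :: "nat \<Rightarrow> real \<Rightarrow> complex"
  assumes c: "c > 0" and cont: "\<And>j. continuous_on {0..} (\<Phi> j)"
    and bd: "\<And>j. \<exists>C. \<forall>t\<ge>0. cmod (\<Phi> j t) \<le> C * exp (- c * t)"
    and der: "\<And>j s. s > 0 \<Longrightarrow> (\<Phi> (Suc j) has_vector_derivative - \<Phi> j s) (at s)" and s: "s > 0"
  shows "(\<integral>(w::complex^'k::finite).  \<Phi> 0 ((norm w)\<^sup>2 + s) \<partial>lborel) = (pi ^ CARD('k)) *\<^sub>R \<Phi> CARD('k) s"
proof -
  define k where "k = CARD('k)"
  have k: "k > 0" by (simp add: k_def)
  define f where "f t = (t ^ (k - 1) / fact (k - 1)) *\<^sub>R \<Phi> 0 (t + s)" for t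
  \<comment> \<open>An explicit primitive of \<open>f\<close> that collects the boundary terms of
    all integrations by parts. Its derivative telescopes to \<open>f\<close>, it tends to 0 at
    infinity, and at 0 only the summand j = 0 survives.\<close>
  define F where "F t = - (\<Sum>j<k. (t ^ j / fact j) *\<^sub>R \<Phi> (k - j) (t + s))" for t
  have conts: "continuous_on {0..} (\<lambda>t. \<Phi> j (t + s))" for j
    using s by (intro continuous_on_compose2[OF cont] continuous_intros) auto
  have [measurable]: "(\<lambda>t. indicator {0..} t *\<^sub>R \<Phi> 0 (t + s)) \<in> borel_measurable borel"
    by (intro borel_measurable_continuous_on_indicator conts) simp
  have "(\<integral>(w::complex^'k).  \<Phi> 0 ((norm w)\<^sup>2 + s) \<partial>lborel)
      = (\<integral>t. indicator {0..} t *\<^sub>R \<Phi> 0 (t + s) \<partial>distr lborel borel (\<lambda>w::complex^'k. (norm w)\<^sup>2))"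
    by (subst integral_distr) simp_all
  also have "\<dots> = (\<integral>t. (pi ^ k * t ^ (k - 1) / fact (k - 1) * indicator {0..} t) *\<^sub>R (indicator {0..} t *\<^sub>R \<Phi> 0 (t + s)) \<partial>lborel)"
  proof -
    have e: "ennreal (pi ^ k * t ^ (k - 1) / fact (k - 1)) * indicator {0..} t
      = ennreal (pi ^ k * t ^ (k - 1) / fact (k - 1) * indicator {0..} t)" for t :: real
      by (auto split: split_indicator)
    show ?thesis
      unfolding distr_norm_square_lborel k_def[symmetric] e
      by (subst integral_density) (auto split: split_indicator)
  qed
  also have "\<dots> = (\<integral>t. pi ^ k *\<^sub>R (indicator {0..} t *\<^sub>R f t) \<partial>lborel)"
    by (intro Bochner_Integration.integral_cong) (auto simp: f_def split: split_indicator)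
  also have "\<dots> = pi ^ k *\<^sub>R (\<integral>t. indicator {0..} t *\<^sub>R f t \<partial>lborel)"
    by (rule integral_scaleR_right)
  \<comment> \<open>Discarding the endpoint, a null set, leaves the open interval over which
    interval integrals are taken.\<close>
  also have "(\<integral>t. indicator {0..} t *\<^sub>R f t \<partial>lborel) = (\<integral>t. indicator {0<..} t *\<^sub>R f t \<partial>lborel)"
  proof (rule integral_cong_AE)
    have cf: "continuous_on {0..} f" unfolding f_def by (intro continuous_intros conts) auto
    then show "(\<lambda>t. indicator {0..} t *\<^sub>R f t) \<in> borel_measurable lborel"
      using borel_measurable_continuous_on_indicator[of "{0..}" f] by simp
    have "continuous_on {0<..} f" using cf by (rule continuous_on_subset) auto
    then show "(\<lambda>t. indicator {0<..} t *\<^sub>R f t) \<in> borel_measurable lborel"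
      using borel_measurable_continuous_on_indicator[of "{0<..}" f] by simp
    show "AE t in lborel. indicator {0..} t *\<^sub>R f t = indicator {0<..} t *\<^sub>R f t"
      using AE_lborel_singleton[of "0::real"] by eventually_elim (auto split: split_indicator)
  qed
  also have "\<dots> = (LBINT t=ereal 0..\<infinity>. f t)"
    by (simp add: interval_lebesgue_integral_def set_lebesgue_integral_def einterval_eq)
  also have "\<dots> = 0 - (- \<Phi> k s)"
  proof (rule interval_integral_FTC_integrable)
    fix t assume "ereal 0 < ereal t"
    then have t: "t > 0" by simp
    have cPhi: "isCont (\<lambda>t. \<Phi> j (t + s)) t" for j
      using conts[of j] t by (auto simp: continuous_on_interior)
    then show "isCont f t" unfolding f_def by (intro continuous_intros) auto
    \<comment> \<open>The case j = 0 is separate: the derivative of t^0 is 0, whereas truncated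
      subtraction would give the nonzero coefficient t^0 / 0!.\<close>
    define A where "A j = (if j = 0 then 0 else (t ^ (j - 1) / fact (j - 1)) *\<^sub>R \<Phi> (k - j) (t + s))" for j
    have tm: "((\<lambda>t. (t ^ j / fact j) *\<^sub>R \<Phi> (k - j) (t + s)) has_vector_derivative - (A (Suc j) - A j)) (at t)"
      if j: "j < k" for j
    proof -
      have d1: "((\<lambda>t. t ^ j / fact j) has_real_derivative (if j = 0 then 0 else t ^ (j - 1) / fact (j - 1))) (at t)"
      proof (cases j)
        case (Suc i)
        have "((\<lambda>t. t ^ j / fact j) has_real_derivative (real j * t ^ (j - 1) / fact j)) (at t)"
          by (auto intro!: derivative_eq_intros)
        also have "real j * t ^ (j - 1) / fact j = t ^ (j - 1) / fact (j - 1)"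
          using Suc by (simp add: fact_Suc del: of_nat_Suc)
        finally show ?thesis using Suc by simp
      qed simp
      obtain i where i: "k - j = Suc i" "k - Suc j = i" using j by (metis Suc_diff_Suc)
      have "(\<Phi> (Suc i) has_vector_derivative - \<Phi> i (t + s)) (at (t + s))"
        using der[of "t + s" i] t s by simp
      then have d2: "((\<lambda>t. \<Phi> (k - j) (t + s)) has_vector_derivative - \<Phi> (k - Suc j) (t + s)) (at t)"
      proof -
        have "((\<lambda>t. t + s) has_vector_derivative 1) (at t)"
          using has_vector_derivative_add[OF has_vector_derivative_id has_vector_derivative_const] by simp
        from vector_diff_chain_at[OF this \<open>(\<Phi> (Suc i) has_vector_derivative _) _\<close>]
        show ?thesis unfolding i by (simp add: o_def)
      qed
      show ?thesis
        using has_vector_derivative_scaleR[OF d1 d2] by (rule has_vector_derivative_eq_rhs) (auto simp: A_def)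
    qed
    have "(F has_vector_derivative - (\<Sum>j<k. - (A (Suc j) - A j))) (at t)"
      unfolding F_def by (intro has_vector_derivative_minus has_vector_derivative_sum tm) auto
    also have "- (\<Sum>j<k. - (A (Suc j) - A j)) = A k - A 0"
      by (simp only: sum_negf sum_lessThan_telescope minus_minus)
    also have "\<dots> = f t" using k by (simp add: A_def f_def)
    finally show "(F has_vector_derivative f t) (at t)" .
  next
    obtain C where C: "\<And>t. t \<ge> 0 \<Longrightarrow> cmod (\<Phi> 0 t) \<le> C * exp (- c * t)" using bd by blast
    have C0: "C \<ge> 0" using order_trans[OF norm_ge_zero C[of 0]] by simp
    have "set_integrable lborel {0<..} (\<lambda>t::real. C / fact (k - 1) * (t ^ (k - 1) * exp (- c * t)))"
    proof (rule set_integrable_mult_right)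
      show "set_integrable lborel {0<..} (\<lambda>t::real. t ^ (k - 1) * exp (- c * t))"
        by (rule set_integrable_subset[OF set_integrable_power_exp[OF c]]) auto
    qed
    then have "set_integrable lborel {0<..} f"
    proof (rule set_integrable_bound)
      have "continuous_on {0<..} f" unfolding f_def
        by (intro continuous_intros continuous_on_subset[OF conts]) auto
      then show "set_borel_measurable lborel {0<..} f"
        using borel_measurable_continuous_on_indicator[of "{0<..}" f] by (simp add: set_borel_measurable_def)
      show "AE t in lborel. t \<in> {0<..} \<longrightarrow> norm (f t) \<le> norm (C / fact (k - 1) * (t ^ (k - 1) * exp (- c * t)))"
      proof (intro AE_I2 impI)
        fix t :: real assume t: "t \<in> {0<..}"
        have "cmod (\<Phi> 0 (t + s)) \<le> C * exp (- c * (t + s))" using C t s by auto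
        also have "C * exp (- c * (t + s)) \<le> C * exp (- c * t)" using C0 c s by (intro mult_left_mono) auto
        finally have "t ^ (k - 1) / fact (k - 1) * cmod (\<Phi> 0 (t + s)) \<le> t ^ (k - 1) / fact (k - 1) * (C * exp (- c * t))"
          using t by (intro mult_left_mono) auto
        then have "norm (f t) \<le> t ^ (k - 1) / fact (k - 1) * (C * exp (- c * t))" using t by (simp add: f_def)
        also have "\<dots> = norm (C / fact (k - 1) * (t ^ (k - 1) * exp (- c * t)))"
          using t C0 by (simp add: abs_mult)
        finally show "norm (f t) \<le> norm (C / fact (k - 1) * (t ^ (k - 1) * exp (- c * t)))" .
      qed
    qed
    then show "set_integrable lborel (einterval (ereal 0) \<infinity>) f" by (simp add: einterval_eq)
  next
    have "F 0 = - \<Phi> k s"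
    proof -
      have "(\<Sum>j<k. (0 ^ j / fact j) *\<^sub>R \<Phi> (k - j) (0 + s)) = (\<Sum>j<k. if j = 0 then \<Phi> k s else 0)"
        by (intro sum.cong) auto
      then show ?thesis using k by (simp add: F_def)
    qed
    moreover have "continuous_on {0..} F" unfolding F_def by (intro continuous_intros conts) auto
    then have "(F \<longlongrightarrow> F 0) (at 0 within {0..})" by (simp add: continuous_on_def)
    then have "(F \<longlongrightarrow> F 0) (at_right 0)" by (rule tendsto_within_subset) auto
    ultimately show "((F \<circ> real_of_ereal) \<longlongrightarrow> - \<Phi> k s) (at_right (ereal 0))"
      by (simp add: ereal_tendsto_simps)
  next
    have "((\<lambda>t. (t ^ j / fact j) *\<^sub>R \<Phi> i (t + s)) \<longlongrightarrow> 0) at_top" for i j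
    proof -
      obtain C where C: "\<And>t. t \<ge> 0 \<Longrightarrow> cmod (\<Phi> i t) \<le> C * exp (- c * t)" using bd by blast
      have C0: "C \<ge> 0" using order_trans[OF norm_ge_zero C[of 0]] by simp
      \<comment> \<open>The limit of x^j / exp x is used at x = c t, which is why the constant is
        divided by c^j.\<close>
      have "filterlim (\<lambda>t::real. c * t) at_top at_top"
        using c by (simp add: filterlim_tendsto_pos_mult_at_top[OF tendsto_const] filterlim_ident)
      from filterlim_compose[OF tendsto_power_div_exp_0 this, of j]
      have "((\<lambda>t. (C / fact j / c ^ j) * ((c * t) ^ j / exp (c * t))) \<longlongrightarrow> (C / fact j / c ^ j) * 0) at_top"
        by (intro tendsto_mult tendsto_const)
      then show ?thesis
      proof (rule Lim_null_comparison[rotated, OF tendsto_eq_rhs])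
        show "\<forall>\<^sub>F t in at_top. norm ((t ^ j / fact j) *\<^sub>R \<Phi> i (t + s)) \<le> (C / fact j / c ^ j) * ((c * t) ^ j / exp (c * t))"
          using eventually_ge_at_top[of 0]
        proof eventually_elim
          fix t :: real assume t: "0 \<le> t"
          have "cmod (\<Phi> i (t + s)) \<le> C * exp (- c * (t + s))" using C t s by auto
          also have "C * exp (- c * (t + s)) \<le> C * exp (- c * t)" using C0 c s by (intro mult_left_mono) auto
          finally have "t ^ j / fact j * cmod (\<Phi> i (t + s)) \<le> t ^ j / fact j * (C * exp (- c * t))"
            using t by (intro mult_left_mono) auto
          then have "norm ((t ^ j / fact j) *\<^sub>R \<Phi> i (t + s)) \<le> t ^ j / fact j * (C * exp (- c * t))"
            using t by simp
          also have "\<dots> = (C / fact j / c ^ j) * ((c * t) ^ j / exp (c * t))"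
            using c by (simp add: exp_minus power_mult_distrib field_simps)
          finally show "norm ((t ^ j / fact j) *\<^sub>R \<Phi> i (t + s)) \<le> (C / fact j / c ^ j) * ((c * t) ^ j / exp (c * t))" .
        qed
      qed simp
    qed
    then have "(F \<longlongrightarrow> - (\<Sum>j<k. 0)) at_top"
      unfolding F_def by (intro tendsto_minus tendsto_sum) auto
    then show "((F \<circ> real_of_ereal) \<longlongrightarrow> 0) (at_left \<infinity>)"
      by (simp add: ereal_tendsto_simps)
  qed simp
  finally show ?thesis by (simp add: k_def)
qed

text \<open>No derivative is taken under the integral. By the preceding lemma
  \<open>\<psi> 0\<close> is pi^k times the k-th tail integral of \<phi>. Differentiation raises the
  index of \<psi> and lowers that of the tail integral, with the same sign, so uniqueness of
  derivatives leads step by step to \<phi> itself.\<close>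

lemma iterated_derivative_integral_norm_square:
  fixes \<phi> :: "real \<Rightarrow> complex" and \<psi> :: "nat \<Rightarrow> real \<Rightarrow> complex"
  assumes c: "c > 0" and cont: "continuous_on {0..} \<phi>" and bd: "\<And>t. t \<ge> 0 \<Longrightarrow> cmod (\<phi> t) \<le> C * exp (- c * t)"
    and der: "\<And>j s. s > 0 \<Longrightarrow> (\<psi> j has_vector_derivative - \<psi> (Suc j) s) (at s)"
    and eq: "\<And>s. s > 0 \<Longrightarrow> \<psi> 0 s = (\<integral>(w::complex^'k::finite).  \<phi> ((norm w)\<^sup>2 + s) \<partial>lborel)"
    and s: "s > 0"
  shows "\<psi> CARD('k) s = (pi ^ CARD('k)) *\<^sub>R \<phi> s"
proof -
  define k where "k = CARD('k)"
  from decaying_antiderivatives[OF c cont bd] obtain \<Phi> where \<Phi>: "\<Phi> 0 = \<phi>" "\<And>j. continuous_on {0..} (\<Phi> j)"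
    "\<And>j. \<exists>C. \<forall>t\<ge>0. cmod (\<Phi> j t) \<le> C * exp (- c * t)"
    "\<And>j s. s > 0 \<Longrightarrow> (\<Phi> (Suc j) has_vector_derivative - \<Phi> j s) (at s)" by metis
  have "\<psi> j s = (pi ^ k) *\<^sub>R \<Phi> (k - j) s" if "j \<le> k" "s > 0" for j s
    using that
  proof (induction j arbitrary: s)
    case 0
    then show ?case
      using eq[of s] integral_norm_square_antiderivative[of c \<Phi> s, where 'k = 'k] c \<Phi>(2-4) by (simp add: k_def \<Phi>(1))
  next
    case (Suc j)
    obtain i where i: "k - j = Suc i" "k - Suc j = i" using Suc.prems by (metis Suc_diff_Suc Suc_le_lessD)
    have "((\<lambda>s. (pi ^ k) *\<^sub>R \<Phi> (k - j) s) has_vector_derivative (pi ^ k) *\<^sub>R (- \<Phi> i s)) (at s)"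
      unfolding i by (rule bounded_linear.has_vector_derivative[OF bounded_linear_scaleR_right \<Phi>(4)[OF Suc.prems(2)]])
    then have "(\<psi> j has_vector_derivative (pi ^ k) *\<^sub>R (- \<Phi> i s)) (at s)"
      by (rule has_vector_derivative_transform_within_open[where S = "{0<..}"]) (use Suc in auto)
    from vector_derivative_unique_at[OF this der[OF Suc.prems(2)]] show ?case by (simp add: i)
  qed
  from this[of k s] s \<Phi>(1) show ?thesis by (simp add: k_def)
qed

section \<open>The kernel of the inflated domain\<close>

lemma integral_dscale:
  fixes c :: "'a::finite \<Rightarrow> complex" and f :: "complex^'a \<Rightarrow> 'b::{banach, second_countable_topology}"
  assumes c: "\<And>i. c i \<noteq> 0" and f [measurable]: "f \<in> borel_measurable borel"
  shows "integral\<^sup>L lborel f = (\<Prod>i\<in>UNIV. (cmod (c i))\<^sup>2) *\<^sub>R (\<integral>x. f (dscale c x) \<partial>lborel)" (is ?int)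
    and "integrable lborel f \<longleftrightarrow> integrable lborel (\<lambda>x. f (dscale c x))" (is ?int')
proof -
  have "integral\<^sup>L lborel f = integral\<^sup>L (distr (density lborel (\<lambda>_. ennreal (\<Prod>i\<in>UNIV. (cmod (c i))\<^sup>2))) borel (dscale c)) f"
    unfolding distr_density_dscale[OF c] ..
  also have "\<dots> = (\<integral>x. (\<Prod>i\<in>UNIV. (cmod (c i))\<^sup>2) *\<^sub>R f (dscale c x) \<partial>lborel)"
    by (subst integral_distr, simp, simp, subst integral_density) (simp_all add: prod_nonneg)
  finally show ?int by simp
  have "integrable lborel f \<longleftrightarrow> integrable (distr (density lborel (\<lambda>_. ennreal (\<Prod>i\<in>UNIV. (cmod (c i))\<^sup>2))) borel (dscale c)) f"
    unfolding distr_density_dscale[OF c] ..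
  also have "\<dots> \<longleftrightarrow> integrable lborel (\<lambda>x. (\<Prod>i\<in>UNIV. (cmod (c i))\<^sup>2) *\<^sub>R f (dscale c x))"
    by (subst integrable_distr_eq, simp, simp, subst integrable_density) (simp_all add: prod_nonneg)
  also have "\<dots> \<longleftrightarrow> integrable lborel (\<lambda>x. f (dscale c x))"
  proof
    have n: "(\<Prod>i\<in>UNIV. (cmod (c i))\<^sup>2) \<noteq> 0" using c by (simp add: prod_zero_iff)
    assume "integrable lborel (\<lambda>x. (\<Prod>i\<in>UNIV. (cmod (c i))\<^sup>2) *\<^sub>R f (dscale c x))"
    then have "integrable lborel (\<lambda>x. inverse (\<Prod>i\<in>UNIV. (cmod (c i))\<^sup>2) *\<^sub>R ((\<Prod>i\<in>UNIV. (cmod (c i))\<^sup>2) *\<^sub>R f (dscale c x)))"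
      by (rule integrable_scaleR_right)
    then show "integrable lborel (\<lambda>x. f (dscale c x))" using n by simp
  qed (rule integrable_scaleR_right)
  finally show ?int' .
qed

lemma continuous_on_zexp [continuous_intros]:
  "continuous_on S f \<Longrightarrow> continuous_on S (\<lambda>t. zexp Z \<gamma> (f t) i)"
  unfolding zexp_def by (cases "i \<in> Z") (auto intro!: continuous_intros)

lemma bounded_linear_cinner_left: "bounded_linear (\<lambda>w. cinner w e)"
  for e :: "complex^'k::finite"
proof -
  have "linear (\<lambda>w. cinner w e)"
    by (rule linearI) (simp_all add: cinner_def algebra_simps sum.distrib scaleR_sum_right)
  then show ?thesis by (simp add: linear_conv_bounded_linear)
qed

lemma continuous_on_cinner [continuous_intros]:
  "continuous_on S f \<Longrightarrow> continuous_on S (\<lambda>t. cinner (f t) (e :: complex^'k::finite))"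
  by (rule continuous_on_compose2[OF linear_continuous_on[OF bounded_linear_cinner_left]]) auto

lemma cinner_smult: "cinner (c *s w) e = c * cinner w e"
  by (simp add: cinner_def sum_distrib_left mult.assoc)

lemma cinner_0_right [simp]: "cinner w 0 = 0"
  by (simp add: cinner_def)

lemma cinner_self: "cinner e e = complex_of_real ((norm e)\<^sup>2)"
  for e :: "complex^'k::finite"
proof -
  have "cinner e e = (\<Sum>i\<in>UNIV. complex_of_real ((cmod (e $ i))\<^sup>2))"
    unfolding cinner_def by (intro sum.cong refl) (rule complex_norm_square[symmetric])
  also have "\<dots> = complex_of_real ((norm e)\<^sup>2)"
    unfolding norm_vec_def L2_set_def by (simp add: sum_nonneg)
  finally show ?thesis .
qed

lemma Re_cinner: "Re (cinner w e) = w \<bullet> e"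
  for e :: "complex^'k::finite"
  by (simp add: cinner_def inner_vec_def inner_complex_def)

lemma bounded_linear_vector_scalar_mult_right: "bounded_linear (\<lambda>w::complex^'k::finite. u *s w)"
proof -
  have "(\<lambda>w::complex^'k. u *s w) = dscale (\<lambda>_. u)" by (auto simp: vec_eq_iff)
  then show ?thesis by (simp add: bounded_linear_dscale)
qed

section \<open>Skew automorphisms of the inflated domain\<close>

abbreviation sm2 :: "complex \<Rightarrow> (complex^'a) \<times> (complex^'k) \<Rightarrow> (complex^'a) \<times> (complex^'k)" where
  "sm2 \<equiv> (\<lambda>c (a, b). (c *s a, c *s b))"

text \<open>One family for both kinds of symmetry: \<open>e = 0\<close>, \<open>b = 0\<close>,
  \<open>a = 0\<close> gives the rotations of w, while \<open>u = 1\<close>, \<open>a = - e\<close>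
  with a suitable b moves w = e to 0.\<close>

definition skew :: "'a set \<Rightarrow> ('a \<Rightarrow> real) \<Rightarrow> complex^'k \<Rightarrow> complex \<Rightarrow> complex \<Rightarrow> complex^'k
    \<Rightarrow> (complex^'a) \<times> (complex^'k) \<Rightarrow> (complex^'a) \<times> (complex^'k)" where
  "skew Z \<gamma> e b u a p = (dscale (zexp Z \<gamma> (cinner (snd p) e + b)) (fst p), u *s snd p + a)"

lemma exp_affine_has_derivative:
  fixes e :: "complex^'k::finite"
  shows "((\<lambda>p::(complex^'a::finite) \<times> (complex^'k). exp (c * (cinner (snd p) e + b))) has_derivative
    (\<lambda>h. exp (c * (cinner (snd p) e + b)) * (c * cinner (snd h) e))) (at p)"
proof -
  have 1: "((\<lambda>p::(complex^'a) \<times> (complex^'k). c * (cinner (snd p) e + b)) has_derivative (\<lambda>h. c * (cinner (snd h) e + 0))) (at p)"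
    by (intro has_derivative_mult_right has_derivative_add has_derivative_const
        bounded_linear.has_derivative[OF bounded_linear_cinner_left] has_derivative_snd has_derivative_ident)
  have 2: "(exp has_derivative (\<lambda>h. exp z * h)) (at z)" for z :: complex
    using DERIV_exp[of z] by (simp add: has_field_derivative_def)
  show ?thesis using has_derivative_compose[OF 1 2] by simp
qed

lemma holo_map_on_skew:
  fixes e a :: "complex^'k::finite" and Z :: "'a::finite set"
  shows "holo_map_on sm2 sm2 U (skew Z \<gamma> e b u a)"
  unfolding holo_map_on_def
proof
  fix p :: "(complex^'a) \<times> (complex^'k)"
  define E where "E i = zexp Z \<gamma> (cinner (snd p) e + b) i" for i
  define D where "D h i = (if i \<in> Z then complex_of_real (\<gamma> i) * cinner (snd h) e * E i * fst p $ i else 0) + E i * fst h $ i"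
    for h :: "(complex^'a) \<times> (complex^'k)" and i
  have comp: "((\<lambda>p. zexp Z \<gamma> (cinner (snd p) e + b) i * fst p $ i) has_derivative (\<lambda>h. D h i)) (at p)" for i
  proof -
    have n: "((\<lambda>p. fst p $ i) has_derivative (\<lambda>h. fst h $ i)) (at p)"
      by (intro bounded_linear.has_derivative[OF bounded_linear_vec_nth] has_derivative_fst has_derivative_ident)
    show ?thesis
    proof (cases "i \<in> Z")
      case True
      show ?thesis
        using has_derivative_mult[OF exp_affine_has_derivative[of "complex_of_real (\<gamma> i)" e b p] n] True
        by (simp add: zexp_def D_def E_def algebra_simps)
    next
      case False then show ?thesis using n by (simp add: zexp_def D_def E_def)
    qed
  qed
  note bu = bounded_linear_vector_scalar_mult_right[of u]
  have "((\<lambda>p. u *s snd p + a) has_derivative (\<lambda>h. u *s snd h + 0)) (at p)"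
    by (intro has_derivative_add has_derivative_const bounded_linear.has_derivative[OF bu] has_derivative_snd has_derivative_ident)
  then have "(skew Z \<gamma> e b u a has_derivative (\<lambda>h. (\<chi> i. D h i, u *s snd h + 0))) (at p)"
    unfolding skew_def[abs_def] dscale_def by (intro has_derivative_Pair has_derivative_vecI comp)
  moreover have "(\<chi> i. D (sm2 c h) i, u *s snd (sm2 c h) + 0) = sm2 c (\<chi> i. D h i, u *s snd h + 0)" for c h
    by (auto simp: D_def split_beta vec_eq_iff cinner_smult algebra_simps)
  ultimately show "\<exists>T'. (skew Z \<gamma> e b u a has_derivative T') (at p) \<and> (\<forall>c v. T' (sm2 c v) = sm2 c (T' v))"
    by blast
qed

text \<open>The full complex Jacobian has a further factor of modulus 1, a power of u from the
  second component. It would cancel against its conjugate, so J keeps only the scaling part.\<close>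

lemma bergman_kernel_skew:
  fixes e a :: "complex^'k::finite" and Z :: "'a::finite set"
  assumes V: "open V" and K: "is_bergman_kernel_sm sm2 V K" and u: "cmod u = 1"
    and inv: "\<And>p. skew Z \<gamma> e b u a p \<in> V \<longleftrightarrow> p \<in> V" and p: "p \<in> V" and q: "q \<in> V"
  defines "J \<equiv> \<lambda>p::(complex^'a) \<times> (complex^'k). exp (complex_of_real (\<Sum>j\<in>Z. \<gamma> j) * (cinner (snd p) e + b))"
  shows "K p q = J p * cnj (J q) * K (skew Z \<gamma> e b u a p) (skew Z \<gamma> e b u a q)"
proof -
  define u' where "u' = inverse u"
  have u0: "u \<noteq> 0" using u by auto
  define a' where "a' = - (u' *s a)"
  \<comment> \<open>The inverse lies in the same family. The conjugate appears because
    \<open>cinner\<close> is antilinear in its second argument, and \<open>b'\<close> makes the two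
    scaling times add up to 0.\<close>
  define e' where "e' = - (cnj u' *s e)"
  define b' where "b' = - (cinner a' e + b)"
  have ce: "cinner w e' = - (u' * cinner w e)" for w
    by (simp add: cinner_def e'_def sum_negf sum_distrib_left mult_ac)
  have cadd: "cinner (w + z) e = cinner w e + cinner z e" for w z
    by (simp add: cinner_def algebra_simps sum.distrib)
  have cneg: "cinner (- w) e = - cinner w e" for w
    by (simp add: cinner_def sum_negf)
  have uu: "u' * u = 1" "u * u' = 1" using u0 by (simp_all add: u'_def)
  have ssm: "c *s (d *s w) = (c * d) *s w" for c d :: complex and w :: "complex^'k" by (simp add: vec_eq_iff)
  have ST: "skew Z \<gamma> e' b' u' a' (skew Z \<gamma> e b u a p) = p" for p
  proof -
    have "cinner (u *s snd p + a) e' + b' + (cinner (snd p) e + b) = 0"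
      using uu by (simp add: ce cadd cinner_smult b'_def a'_def cneg algebra_simps flip: mult.assoc)
    moreover have "u' *s (u *s snd p + a) + a' = snd p"
      by (simp add: a'_def vector_add_ldistrib ssm uu)
    ultimately show ?thesis
      by (simp add: skew_def dscale_zexp_add)
  qed
  have TS: "skew Z \<gamma> e b u a (skew Z \<gamma> e' b' u' a' p) = p" for p
  proof -
    have "cinner (u' *s snd p + a') e + b + (cinner (snd p) e' + b') = 0"
      by (simp add: ce cadd cinner_smult b'_def)
    moreover have "u *s (u' *s snd p + a') + a = snd p"
      by (simp add: a'_def vector_add_ldistrib ssm uu vec_eq_iff flip: mult.assoc)
    ultimately show ?thesis
      by (simp add: skew_def dscale_zexp_add)
  qed
  have cw: "continuous_on UNIV (\<lambda>w::complex^'k. u *s w + a)"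
    by (intro continuous_intros linear_continuous_on bounded_linear_vector_scalar_mult_right)
  have cT: "continuous_on UNIV (skew Z \<gamma> e b u a)"
    unfolding skew_def[abs_def]
    by (intro continuous_intros continuous_on_compose2[OF cw]) auto
  have "is_bergman_kernel_sm sm2 V (\<lambda>p q. J p * cnj (J q) * K (skew Z \<gamma> e b u a p) (skew Z \<gamma> e b u a q))"
  proof (rule bergman_kernel_transform[OF V V inv ST TS holo_map_on_skew holo_map_on_skew _ _ _ _ _ K])
    show "holo_on_sm sm2 V J"
      unfolding holo_on_sm_def J_def
      by (intro ballI exI conjI, rule exp_affine_has_derivative) (auto simp: cinner_smult)
    show "J x \<noteq> 0" for x by (simp add: J_def)
    show "skew Z \<gamma> e b u a \<in> borel_measurable borel"
      using cT by (rule borel_measurable_continuous_onI)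
    show "J \<in> borel_measurable borel"
      unfolding J_def by (intro borel_measurable_continuous_onI continuous_intros)
    have "distr (density lborel (\<lambda>p. ennreal (\<Prod>i\<in>UNIV. (cmod (zexp Z \<gamma> (cinner (snd p) e + b) i))\<^sup>2))) borel
        (\<lambda>p. (dscale (zexp Z \<gamma> (cinner (snd p) e + b)) (fst p), u *s snd p + a)) = lborel"
      by (rule distr_density_skew[where c = "\<lambda>w. zexp Z \<gamma> (cinner w e + b)" and A = "\<lambda>w. u *s w + a"])
         (auto intro!: zexp_nonzero continuous_intros borel_measurable_continuous_onI cw distr_lborel_rotate_translate u)
    then show "distr (density lborel (\<lambda>x. ennreal ((cmod (J x))\<^sup>2))) borel (skew Z \<gamma> e b u a) = lborel"
      unfolding prod_norm_zexp J_def skew_def[abs_def] .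
  qed
  from bergman_kernel_unique[OF K this p q] show ?thesis .
qed

section \<open>Membership in the inflated domain and its slices\<close>

lemma g_map_eq: "g_map Z \<gamma> x w = dscale (zexp Z \<gamma> (complex_of_real ((norm w)\<^sup>2 / 2))) x"
  by (simp add: g_map_def zexp_def vec_eq_iff exp_of_real[symmetric])

lemma l_map_eq: "l_map Z \<gamma> x w e = dscale (zexp Z \<gamma> (cinner w e - complex_of_real ((norm e)\<^sup>2))) x"
  by (simp add: l_map_def zexp_def vec_eq_iff mult.commute)

lemma V_gamma_iff: "p \<in> V_gamma Z \<gamma> \<Omega> \<longleftrightarrow> dscale (zexp Z \<gamma> (complex_of_real ((norm (snd p))\<^sup>2 / 2))) (fst p) \<in> \<Omega>"
  by (cases p) (simp add: V_gamma_def g_map_eq)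

lemma V_slice_iff: "x \<in> V_slice Z \<gamma> \<Omega> e \<longleftrightarrow> dscale (zexp Z \<gamma> (complex_of_real ((norm e)\<^sup>2 / 2))) x \<in> \<Omega>"
  by (simp add: V_slice_def V_gamma_iff)

lemma V_slice_0: "V_slice Z \<gamma> \<Omega> 0 = \<Omega>"
  by (auto simp: V_slice_iff)

lemma open_V_gamma:
  assumes "open (\<Omega> :: (complex^'a::finite) set)"
  shows "open (V_gamma Z \<gamma> \<Omega> :: ((complex^'a) \<times> (complex^'k::finite)) set)"
proof -
  have "(V_gamma Z \<gamma> \<Omega> :: ((complex^'a) \<times> (complex^'k)) set) = (\<lambda>p. dscale (zexp Z \<gamma> (complex_of_real ((norm (snd p))\<^sup>2 / 2))) (fst p)) -` \<Omega>"
    by (auto simp: V_gamma_iff)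
  moreover have "continuous_on UNIV (\<lambda>p :: (complex^'a) \<times> (complex^'k). dscale (zexp Z \<gamma> (complex_of_real ((norm (snd p))\<^sup>2 / 2))) (fst p))"
    by (intro continuous_intros) auto
  then have "open ((\<lambda>p :: (complex^'a) \<times> (complex^'k). dscale (zexp Z \<gamma> (complex_of_real ((norm (snd p))\<^sup>2 / 2))) (fst p)) -` \<Omega>)"
    by (intro continuous_open_vimage assms) (simp add: continuous_on_eq_continuous_at del: split_paired_All)
  ultimately show ?thesis by (simp only:)
qed

text \<open>K is the kernel of the zero slice, which is \<Omega> itself. The other slices are
  scalings of it and come in only in the final theorem.\<close>

locale hartogs_kernels =
  fixes Z :: "'a::finite set" and \<gamma> :: "'a \<Rightarrow> real" and \<Omega> :: "(complex^'a) set"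
    and KV :: "(complex^'a) \<times> (complex^'k::finite) \<Rightarrow> (complex^'a) \<times> (complex^'k) \<Rightarrow> complex"
    and K :: "complex^'a \<Rightarrow> complex^'a \<Rightarrow> complex"
  assumes Z: "Z \<noteq> {}" and \<Omega>: "open \<Omega>" and st: "star_hartogs Z \<Omega>" and \<gamma>: "\<forall>j\<in>Z. \<gamma> j > 0"
    and KV: "is_bergman_kernel_sm sm2 (V_gamma Z \<gamma> \<Omega>) KV" and K: "is_bergman_kernel_sm (*s) \<Omega> K"
begin

abbreviation V where "V \<equiv> (V_gamma Z \<gamma> \<Omega> :: ((complex^'a) \<times> (complex^'k)) set)"

abbreviation flow where "flow \<tau> \<equiv> dscale (zexp Z \<gamma> \<tau>)"

definition c where "c = (\<Sum>j\<in>Z. \<gamma> j)"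

lemma c_pos: "c > 0"
  unfolding c_def using Z \<gamma> by (intro sum_pos) auto

lemma flow_mem: "flow a x \<in> \<Omega> \<Longrightarrow> Re b \<le> Re a \<Longrightarrow> flow b x \<in> \<Omega>"
  using star_hartogs_zexp[OF st \<gamma>] by blast

lemma flow_nonpos_mem: "x \<in> \<Omega> \<Longrightarrow> Re b \<le> 0 \<Longrightarrow> flow b x \<in> \<Omega>"
  using flow_mem[of 0 x b] by simp

lemma V_fst_mem: "p \<in> V \<Longrightarrow> fst p \<in> \<Omega>"
  unfolding V_gamma_iff using flow_mem[of _ "fst p" 0] by simp

lemma zero_mem_V: "x \<in> \<Omega> \<Longrightarrow> (x, 0) \<in> V"
  by (simp add: V_gamma_iff)

lemma holo_K: "y \<in> \<Omega> \<Longrightarrow> holo_on_sm (*s) \<Omega> (\<lambda>x. K x y)"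
  using bergman_kernel_in_space[OF K] by (simp add: bergman_space_sm_def)

text \<open>The multipliers of a backward flow are real and at most 1, so the contraction identity
  applies and the conjugate disappears.\<close>

lemma K_flow:
  assumes "x \<in> \<Omega>" "y \<in> \<Omega>" "t \<ge> 0"
  shows "K (flow (- complex_of_real t) x) y = K x (flow (- complex_of_real t) y)"
proof -
  have "(\<lambda>i. cnj (zexp Z \<gamma> (- complex_of_real t) i)) = zexp Z \<gamma> (- complex_of_real t)"
    by (auto simp: zexp_def exp_cnj)
  moreover have "cmod (zexp Z \<gamma> (- complex_of_real t) i) \<le> 1" if "i \<in> Z" for i
    using that \<gamma> assms(3) by (auto simp: zexp_def)
  ultimately show ?thesis
    using bergman_kernel_contraction[OF \<Omega> st K, of "zexp Z \<gamma> (- complex_of_real t)" x y] assms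
    by (simp add: zexp_def)
qed

text \<open>The backward orbit lies in the image of the compact set P under the scalings of x.
  Star-shapedness keeps this image inside \<Omega>, including the limit point with vanishing
  z-coordinates that the orbit approaches.\<close>

lemma orbit_bounded:
  fixes f :: "complex^'a \<Rightarrow> complex"
  assumes f: "continuous_on \<Omega> f" and x: "x \<in> \<Omega>"
  shows "\<exists>B. \<forall>t\<ge>0. cmod (f (flow (- complex_of_real t) x)) \<le> B"
proof -
  define P where "P = {l::complex^'a. (\<forall>i. cmod (l $ i) \<le> 1) \<and> (\<forall>i. i \<notin> Z \<longrightarrow> l $ i = 1)}"
  have Peq: "P = (\<Inter>i. {l. cmod (l $ i) \<le> 1}) \<inter> (\<Inter>i\<in>- Z. {l. l $ i = 1})"
    by (auto simp: P_def)
  have "closed P"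
    unfolding Peq by (intro closed_Int closed_INT ballI closed_Collect_le closed_Collect_eq continuous_intros)
  moreover have "norm l \<le> real CARD('a)" if "l \<in> P" for l
  proof -
    have "norm l \<le> (\<Sum>i\<in>UNIV. cmod (l $ i))" unfolding norm_vec_def by (rule L2_set_le_sum) simp
    also have "\<dots> \<le> (\<Sum>i\<in>(UNIV::'a set). 1)" using that by (intro sum_mono) (auto simp: P_def)
    finally show ?thesis by simp
  qed
  then have "bounded P" by (auto simp: bounded_iff)
  ultimately have "compact P" by (simp add: compact_eq_bounded_closed)
  moreover have "continuous_on P (\<lambda>l. f (dscale (($) l) x))"
  proof (rule continuous_on_compose2[OF f])
    show "continuous_on P (\<lambda>l. dscale (($) l) x)" by (intro continuous_intros)
    show "(\<lambda>l. dscale (($) l) x) ` P \<subseteq> \<Omega>"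
      using star_hartogs_dscale[OF st x] by (auto simp: P_def)
  qed
  ultimately have "compact ((\<lambda>l. f (dscale (($) l) x)) ` P)" by (rule compact_continuous_image[rotated])
  then obtain B where B: "\<And>l. l \<in> P \<Longrightarrow> cmod (f (dscale (($) l) x)) \<le> B"
    using compact_imp_bounded bounded_iff by (metis imageI)
  have "cmod (f (flow (- complex_of_real t) x)) \<le> B" if "t \<ge> 0" for t
  proof -
    have "(\<chi> i. zexp Z \<gamma> (- complex_of_real t) i) \<in> P"
      using that \<gamma> by (auto simp: P_def zexp_def)
    from B[OF this] show ?thesis by (simp add: dscale_def)
  qed
  then show ?thesis by blast
qed

text \<open>On the disc of points (x, l w) with |l| <= 1 the kernel is holomorphic in l, and
  rotations of w make it constant on the boundary circle, so the center has the same value. The disc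
  stays in \<open>V\<close> because the fibres of \<open>V\<close> shrink as |w| grows.\<close>

lemma KV_indep_w:
  assumes p: "(x, w) \<in> V" and y: "y \<in> \<Omega>"
  shows "KV (x, w) (y, 0) = KV (x, 0) (y, 0)"
proof -
  have VO: "open V" using \<Omega> by (rule open_V_gamma)
  have kv: "holo_on_sm sm2 V (\<lambda>p. KV p (y, 0))"
    using bergman_kernel_in_space[OF KV zero_mem_V[OF y]] by (simp add: bergman_space_sm_def)
  have nu: "norm (u *s w) = cmod u * norm w" for u w by (rule norm_vector_scalar_mult_complex)
  have inv: "skew Z \<gamma> 0 0 u 0 p \<in> V \<longleftrightarrow> p \<in> V" if "cmod u = 1" for u p
    using that by (simp add: V_gamma_iff skew_def nu)
  have rot: "KV (x, w) (y, 0) = KV (x, u *s w) (y, 0)" if u: "cmod u = 1" for u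
    using bergman_kernel_skew[OF VO KV u inv[OF u] p zero_mem_V[OF y]] by (simp add: skew_def)
  have bl: "bounded_linear (\<lambda>l. sm2 l (0 :: complex^'a, w))"
    using bounded_linear_Pair[OF bounded_linear_zero bounded_linear_vector_scalar_mult_left[of w]] by simp
  have line: "(x, 0) + sm2 l (0, w) = (x, l *s w)" for l by simp
  have "KV (x, 0 *s w) (y, 0) = KV (x, w) (y, 0)"
  proof (rule holomorphic_eq_on_cball[where f = "\<lambda>l. KV (x, l *s w) (y, 0)" and g = "\<lambda>_. KV (x, w) (y, 0)" and W = "{l. (x, l *s w) \<in> V}"])
    show "(\<lambda>l. KV (x, l *s w) (y, 0)) holomorphic_on {l. (x, l *s w) \<in> V}"
      using holo_on_sm_line[where sm = sm2, OF kv bl, of "(x, 0)"] unfolding line .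
    show "open {l. (x, l *s w) \<in> V}"
      using open_line_vimage[where sm = sm2, OF VO bl, of "(x, 0)"] unfolding line .
    show "cball 0 1 \<subseteq> {l. (x, l *s w) \<in> V}"
    proof
      fix l :: complex assume "l \<in> cball 0 1"
      then have "cmod l \<le> 1" by simp
      then have "(cmod l * norm w)\<^sup>2 \<le> (norm w)\<^sup>2"
        by (intro power_mono) (auto intro: mult_left_le_one_le)
      then show "l \<in> {l. (x, l *s w) \<in> V}"
        using p unfolding V_gamma_iff by (auto simp: nu intro: flow_mem)
    qed
  qed (use rot in auto)
  then show ?thesis by simp
qed

lemma holo_KV_slice:
  assumes y: "y \<in> \<Omega>"
  shows "holo_on_sm (*s) \<Omega> (\<lambda>x. KV (x, 0) (y, 0))"
proof (rule holo_on_sm_compose[where f = "\<lambda>p. KV p (y, 0)" and U' = V and sm' = sm2])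
  show "holo_on_sm sm2 V (\<lambda>p. KV p (y, 0))"
    using bergman_kernel_in_space[OF KV zero_mem_V[OF y]] by (simp add: bergman_space_sm_def)
  show "holo_map_on (*s) sm2 \<Omega> (\<lambda>x. (x, 0::complex^'k))"
    unfolding holo_map_on_def
    by (intro ballI exI[of _ "\<lambda>h. (h, 0)"] conjI has_derivative_Pair has_derivative_ident has_derivative_const) auto
qed (rule zero_mem_V)

text \<open>Reproduction of \<open>K _ z\<close> at z. The nonnegative integral is the form that
  Tonelli can use before any integrability on \<open>V\<close> is known.\<close>

lemma norm_square_K:
  assumes z: "z \<in> \<Omega>"
  shows "(\<integral>\<^sup>+v. indicator \<Omega> v * ennreal ((cmod (K v z))\<^sup>2) \<partial>lborel) = ennreal (Re (K z z))"
proof -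
  have i: "integrable lborel (\<lambda>v. indicator \<Omega> v *\<^sub>R (cmod (K v z))\<^sup>2)"
    using bergman_kernel_in_space[OF K z] by (simp add: bergman_space_sm_def set_integrable_def)
  have "K z z = set_lebesgue_integral lborel \<Omega> (\<lambda>v. K v z * cnj (K v z))"
    by (rule bergman_kernel_reproduces[OF K bergman_kernel_in_space[OF K z] z])
  also have "\<dots> = (\<integral>v. complex_of_real (indicator \<Omega> v *\<^sub>R (cmod (K v z))\<^sup>2) \<partial>lborel)"
    unfolding set_lebesgue_integral_def
    unfolding complex_norm_square[symmetric]
    by (intro Bochner_Integration.integral_cong refl) (simp add: scaleR_conv_of_real)
  also have "\<dots> = complex_of_real (\<integral>v. indicator \<Omega> v *\<^sub>R (cmod (K v z))\<^sup>2 \<partial>lborel)"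
    by (rule integral_complex_of_real)
  finally have "Re (K z z) = (\<integral>v. indicator \<Omega> v *\<^sub>R (cmod (K v z))\<^sup>2 \<partial>lborel)" by simp
  moreover have "(\<integral>\<^sup>+v. ennreal (indicator \<Omega> v *\<^sub>R (cmod (K v z))\<^sup>2) \<partial>lborel) = ennreal (\<integral>v. indicator \<Omega> v *\<^sub>R (cmod (K v z))\<^sup>2 \<partial>lborel)"
    using i by (rule nn_integral_eq_integral) simp
  moreover have "(\<integral>\<^sup>+v. ennreal (indicator \<Omega> v *\<^sub>R (cmod (K v z))\<^sup>2) \<partial>lborel) = (\<integral>\<^sup>+v. indicator \<Omega> v * ennreal ((cmod (K v z))\<^sup>2) \<partial>lborel)"
    by (intro nn_integral_cong) (auto split: split_indicator)
  ultimately show ?thesis by simp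
qed

lemma prod_norm_flow: "(\<Prod>i\<in>UNIV. (cmod (zexp Z \<gamma> (- complex_of_real ((norm w)\<^sup>2 / 2)) i))\<^sup>2) = exp (- c * (norm w)\<^sup>2)"
  unfolding prod_norm_zexp c_def[symmetric] by (simp add: power2_eq_square flip: exp_add)

lemma V_flow_iff: "(flow (- complex_of_real ((norm w)\<^sup>2 / 2)) v, w) \<in> V \<longleftrightarrow> v \<in> \<Omega>"
  by (simp add: V_gamma_iff dscale_zexp_add)

text \<open>Straighten the fibre over w to \<Omega>; \<open>K_flow\<close> then moves the scaling
  from the variable to the parameter. The fibre integral becomes exp(-c |w|^2) K(z, z) with z on the
  backward orbit of x, and boundedness along that orbit leaves a Gaussian.\<close>

lemma K_in_bergman_space_V:
  assumes x: "x \<in> \<Omega>"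
  shows "(\<lambda>p. K (fst p) x) \<in> bergman_space_sm sm2 V"
proof -
  have "holo_map_on sm2 (*s) V fst"
    unfolding holo_map_on_def
    by (intro ballI exI[of _ fst] conjI has_derivative_fst has_derivative_ident) auto
  then have h: "holo_on_sm sm2 V (\<lambda>p. K (fst p) x)"
    by (rule holo_on_sm_compose[OF holo_K[OF x]]) (rule V_fst_mem)
  obtain B where B: "\<And>t. t \<ge> 0 \<Longrightarrow> cmod (K (flow (- complex_of_real t) x) x) \<le> B"
    using orbit_bounded[OF holo_on_sm_imp_continuous_on[OF holo_K[OF x]] x] by blast
  have VO: "open V" using \<Omega> by (rule open_V_gamma)
  have m: "(\<lambda>p. indicator V p *\<^sub>R (cmod (K (fst p) x))\<^sup>2) \<in> borel_measurable borel"
    using VO holo_on_sm_imp_continuous_on[OF h]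
    by (intro borel_measurable_continuous_on_indicator continuous_intros) auto
  then have m' [measurable]: "(\<lambda>p. indicator V p *\<^sub>R (cmod (K (fst p) x))\<^sup>2) \<in> borel_measurable (borel \<Otimes>\<^sub>M borel)"
    by (simp add: borel_prod)
  have inner: "(\<integral>\<^sup>+u. ennreal (indicator V (u, w) *\<^sub>R (cmod (K u x))\<^sup>2) \<partial>lborel) \<le> ennreal (exp (- c * (norm w)\<^sup>2)) * ennreal B" for w :: "complex^'k"
  proof -
    define r where "r = - complex_of_real ((norm w)\<^sup>2 / 2)"
    define z where "z = flow r x"
    have z: "z \<in> \<Omega>" unfolding z_def r_def using x by (intro flow_nonpos_mem) auto
    have sec: "(\<lambda>u. ennreal (indicator V (u, w) *\<^sub>R (cmod (K u x))\<^sup>2)) \<in> borel_measurable borel"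
      using measurable_compose[OF measurable_Pair2'[of w borel borel] m'] by simp
    have "(\<integral>\<^sup>+u. ennreal (indicator V (u, w) *\<^sub>R (cmod (K u x))\<^sup>2) \<partial>lborel)
       = (\<integral>\<^sup>+v. ennreal (exp (- c * (norm w)\<^sup>2)) * ennreal (indicator V (flow r v, w) *\<^sub>R (cmod (K (flow r v) x))\<^sup>2) \<partial>lborel)"
      using nn_integral_dscale[of "zexp Z \<gamma> r" "\<lambda>u. ennreal (indicator V (u, w) *\<^sub>R (cmod (K u x))\<^sup>2)", OF zexp_nonzero sec]
      unfolding r_def prod_norm_flow by (rule sym)
    also have "\<dots> = (\<integral>\<^sup>+v. ennreal (exp (- c * (norm w)\<^sup>2)) * (indicator \<Omega> v * ennreal ((cmod (K v z))\<^sup>2)) \<partial>lborel)"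
    proof (intro nn_integral_cong)
      fix v
      show "ennreal (exp (- c * (norm w)\<^sup>2)) * ennreal (indicator V (flow r v, w) *\<^sub>R (cmod (K (flow r v) x))\<^sup>2)
        = ennreal (exp (- c * (norm w)\<^sup>2)) * (indicator \<Omega> v * ennreal ((cmod (K v z))\<^sup>2))"
        using V_flow_iff[of w v] K_flow[of v x "(norm w)\<^sup>2 / 2"] x
        by (cases "v \<in> \<Omega>") (auto simp: r_def z_def)
    qed
    also have "\<dots> = ennreal (exp (- c * (norm w)\<^sup>2)) * (\<integral>\<^sup>+v. indicator \<Omega> v * ennreal ((cmod (K v z))\<^sup>2) \<partial>lborel)"
    proof (rule nn_integral_cmult)
      have "(\<lambda>v. indicator \<Omega> v *\<^sub>R (cmod (K v z))\<^sup>2) \<in> borel_measurable borel"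
        using \<Omega> holo_on_sm_imp_continuous_on[OF holo_K[OF z]]
        by (intro borel_measurable_continuous_on_indicator continuous_intros) auto
      then have "(\<lambda>v. ennreal (indicator \<Omega> v *\<^sub>R (cmod (K v z))\<^sup>2)) \<in> borel_measurable lborel"
        by (intro measurable_compose[OF _ measurable_ennreal]) simp
      also have "(\<lambda>v. ennreal (indicator \<Omega> v *\<^sub>R (cmod (K v z))\<^sup>2)) = (\<lambda>v. indicator \<Omega> v * ennreal ((cmod (K v z))\<^sup>2))"
        by (auto split: split_indicator)
      finally show "(\<lambda>v. indicator \<Omega> v * ennreal ((cmod (K v z))\<^sup>2)) \<in> borel_measurable lborel" .
    qed
    also have "\<dots> = ennreal (exp (- c * (norm w)\<^sup>2)) * ennreal (Re (K z z))" by (simp add: norm_square_K[OF z])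
    also have "\<dots> \<le> ennreal (exp (- c * (norm w)\<^sup>2)) * ennreal B"
    proof (intro mult_left_mono ennreal_leI)
      \<comment> \<open>Moving one half of the flow across K puts both halves, of total time |w|^2,
        on the first argument. So K(z, z) is a value of \<open>K _ x\<close> on the orbit, where B
        is a bound.\<close>
      have "K z z = K (flow r z) x" unfolding r_def using K_flow[of z x "(norm w)\<^sup>2 / 2"] z x by (simp add: z_def r_def)
      also have "flow r z = flow (- complex_of_real ((norm w)\<^sup>2)) x" by (simp add: z_def r_def dscale_zexp_add)
      finally have "cmod (K z z) \<le> B" using B[of "(norm w)\<^sup>2"] by simp
      then show "Re (K z z) \<le> B" using complex_Re_le_cmod order_trans by blast
    qed simp
    finally show ?thesis .
  qed
  have "(\<integral>\<^sup>+p. ennreal (norm (indicator V p *\<^sub>R (cmod (K (fst p) x))\<^sup>2)) \<partial>lborel)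
      = (\<integral>\<^sup>+p. ennreal (indicator V p *\<^sub>R (cmod (K (fst p) x))\<^sup>2) \<partial>(lborel \<Otimes>\<^sub>M lborel))"
    by (simp add: lborel_prod)
  also have "\<dots> = (\<integral>\<^sup>+w. \<integral>\<^sup>+u. ennreal (indicator V (u, w) *\<^sub>R (cmod (K u x))\<^sup>2) \<partial>lborel \<partial>lborel)"
    using lborel_pair.nn_integral_snd[of "\<lambda>(u, w). ennreal (indicator V (u, w) *\<^sub>R (cmod (K u x))\<^sup>2)"] m'
    by (simp add: split_beta')
  also have "\<dots> \<le> (\<integral>\<^sup>+(w::complex^'k). ennreal (exp (- c * (norm w)\<^sup>2)) * ennreal B \<partial>lborel)"
    by (intro nn_integral_mono inner)
  also have "\<dots> = (\<integral>\<^sup>+(w::complex^'k). ennreal (exp (- c * (norm w)\<^sup>2)) \<partial>lborel) * ennreal B"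
    by (rule nn_integral_multc) simp
  also have "\<dots> < \<infinity>"
    using nn_integral_gaussian_finite[OF c_pos, where 'k = 'k] by (simp add: ennreal_mult_less_top)
  finally have "set_integrable lborel V (\<lambda>p. (cmod (K (fst p) x))\<^sup>2)"
    unfolding set_integrable_def using m by (intro integrableI_bounded) simp_all
  with h show ?thesis by (simp add: bergman_space_sm_def)
qed

text \<open>\<open>KV\<close> reproduces K(., x) at (y, 0). On the fibre over w its kernel function
  is \<open>G\<close>, and after straightening, the inner integral is an instance of the reproducing
  property of \<Omega>, applied to a scaled \<open>G\<close>.\<close>

lemma K_eq_gaussian_mean:
  assumes x: "x \<in> \<Omega>" and y: "y \<in> \<Omega>"
  shows "K x y = (\<integral>w. exp (- c * (norm w)\<^sup>2) *\<^sub>R KV (flow (- complex_of_real ((norm (w::complex^'k))\<^sup>2)) x, 0) (y, 0) \<partial>lborel)"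
proof -
  define G where "G u = KV (u, 0) (y, 0)" for u
  have hG: "holo_on_sm (*s) \<Omega> G" unfolding G_def by (rule holo_KV_slice[OF y])
  have cG: "continuous_on \<Omega> G" using hG by (rule holo_on_sm_imp_continuous_on)
  have VO: "open V" using \<Omega> by (rule open_V_gamma)
  have ky: "(\<lambda>p. KV p (y, 0)) \<in> bergman_space_sm sm2 V"
    by (rule bergman_kernel_in_space[OF KV zero_mem_V[OF y]])
  note kx = K_in_bergman_space_V[OF x]
  have GV: "KV p (y, 0) = G (fst p)" if "p \<in> V" for p
    using KV_indep_w[of "fst p" "snd p"] that y by (simp add: G_def)
  define F where "F p = indicator V p *\<^sub>R (K (fst p) x * cnj (G (fst p)))" for p
  have Feq: "F = (\<lambda>p. indicator V p *\<^sub>R (K (fst p) x * cnj (KV p (y, 0))))"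
    by (auto simp: F_def GV split: split_indicator)
  have Fi: "integrable lborel F"
    unfolding Feq using bergman_space_mult_cnj_integrable[OF VO kx ky] by (simp add: set_integrable_def)
  have Fi': "integrable (lborel \<Otimes>\<^sub>M lborel) (case_prod (\<lambda>u w. F (u, w)))"
    using Fi by (simp add: lborel_prod)
  \<comment> \<open>Fubini for H shows that the function \<open>b\<close> below is square integrable
    for almost every w, which is what admits it to the Bergman space of \<Omega>.\<close>
  define H where "H p = indicator V p *\<^sub>R (cmod (G (fst p)))\<^sup>2" for p
  have Heq: "H = (\<lambda>p. indicator V p *\<^sub>R (cmod (KV p (y, 0)))\<^sup>2)"
    by (auto simp: H_def GV split: split_indicator)
  have Hi: "integrable lborel H"
    unfolding Heq using ky by (simp add: bergman_space_sm_def set_integrable_def)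
  have Hi': "integrable (lborel \<Otimes>\<^sub>M lborel) (case_prod (\<lambda>u w. H (u, w)))"
    using Hi by (simp add: lborel_prod)
  have sec: "(\<lambda>u. f (u, w)) \<in> borel_measurable borel"
    if "integrable (lborel \<Otimes>\<^sub>M lborel) (case_prod (\<lambda>u w. f (u, w)))"
    for f :: "(complex^'a) \<times> (complex^'k) \<Rightarrow> 'b::{banach, second_countable_topology}" and w
    using measurable_compose[OF measurable_Pair2'[of w lborel lborel] borel_measurable_integrable[OF that]] by simp
  have "AE w in lborel. integrable lborel (\<lambda>u. H (u, w))"
    by (rule lborel_pair.AE_integrable_snd[OF Hi'])
  then have AE: "AE w in lborel. (\<integral>u. F (u, w) \<partial>lborel) = exp (- c * (norm w)\<^sup>2) *\<^sub>R cnj (G (flow (- complex_of_real ((norm w)\<^sup>2)) x))"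
  proof eventually_elim
    fix w :: "complex^'k" assume Hw: "integrable lborel (\<lambda>u. H (u, w))"
    define r where "r = - complex_of_real ((norm w)\<^sup>2 / 2)"
    have rm: "v \<in> \<Omega> \<Longrightarrow> flow r v \<in> \<Omega>" for v unfolding r_def by (intro flow_nonpos_mem) auto
    define z where "z = flow r x"
    have z: "z \<in> \<Omega>" unfolding z_def using x by (rule rm)
    have VO': "indicator V (flow r v, w) = (indicator \<Omega> v :: real)" for v
      using V_flow_iff[of w v] by (simp add: r_def indicator_def)
    have Kr: "K (flow r v) x = K v z" if "v \<in> \<Omega>" for v
      unfolding r_def z_def by (rule K_flow[OF that x]) simp
    define b where "b v = G (flow r v)" for v
    have "integrable lborel (\<lambda>v. H (flow r v, w))"
      using Hw integral_dscale(2)[of "zexp Z \<gamma> r" "\<lambda>u. H (u, w)", OF zexp_nonzero sec[OF Hi']] by simp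
    then have bi: "set_integrable lborel \<Omega> (\<lambda>v. (cmod (b v))\<^sup>2)"
      by (simp add: H_def VO' b_def set_integrable_def)
    have "holo_map_on (*s) (*s) \<Omega> (flow r)"
      unfolding holo_map_on_def
      by (intro ballI exI[of _ "flow r"] conjI bounded_linear_imp_has_derivative[OF bounded_linear_dscale])
         (simp add: vec_eq_iff)
    then have "holo_on_sm (*s) \<Omega> b"
      unfolding b_def by (rule holo_on_sm_compose[OF hG]) (rule rm)
    with bi have b: "b \<in> bergman_space_sm (*s) \<Omega>" by (simp add: bergman_space_sm_def)
    have "(\<integral>u. F (u, w) \<partial>lborel) = exp (- c * (norm w)\<^sup>2) *\<^sub>R (\<integral>v. F (flow r v, w) \<partial>lborel)"
      using integral_dscale(1)[of "zexp Z \<gamma> r" "\<lambda>u. F (u, w)", OF zexp_nonzero sec[OF Fi']]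
      unfolding r_def prod_norm_flow .
    also have "(\<lambda>v. F (flow r v, w)) = (\<lambda>v. indicator \<Omega> v *\<^sub>R cnj (b v * cnj (K v z)))"
    proof
      fix v
      show "F (flow r v, w) = indicator \<Omega> v *\<^sub>R cnj (b v * cnj (K v z))"
        using Kr[of v] by (cases "v \<in> \<Omega>") (simp_all add: F_def VO' b_def)
    qed
    also have "(\<integral>v. indicator \<Omega> v *\<^sub>R cnj (b v * cnj (K v z)) \<partial>lborel)
        = set_lebesgue_integral lborel \<Omega> (\<lambda>v. cnj (b v * cnj (K v z)))"
      by (simp add: set_lebesgue_integral_def)
    \<comment> \<open>The roles are exchanged: K(., z), so far the function to be reproduced, acts
      as the kernel, and the scaled \<open>G\<close> is reproduced.\<close>
    also have "\<dots> = cnj (b z)"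
      unfolding set_lebesgue_integral_cnj bergman_kernel_reproduces[OF K b z] ..
    also have "b z = G (flow (- complex_of_real ((norm w)\<^sup>2)) x)"
      by (simp add: b_def z_def r_def dscale_zexp_add)
    finally show "(\<integral>u. F (u, w) \<partial>lborel) = exp (- c * (norm w)\<^sup>2) *\<^sub>R cnj (G (flow (- complex_of_real ((norm w)\<^sup>2)) x))" .
  qed
  have Gm: "(\<lambda>w::complex^'k. exp (- c * (norm w)\<^sup>2) *\<^sub>R cnj (G (flow (- complex_of_real ((norm w)\<^sup>2)) x))) \<in> borel_measurable lborel"
    unfolding measurable_lborel2
    using x by (intro borel_measurable_continuous_onI continuous_on_compose2[OF cG] continuous_intros)
      (auto intro!: flow_nonpos_mem)
  have "K y x = set_lebesgue_integral lborel V (\<lambda>p. K (fst p) x * cnj (KV p (y, 0)))"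
    using bergman_kernel_reproduces[OF KV kx zero_mem_V[OF y]] by simp
  also have "\<dots> = integral\<^sup>L (lborel \<Otimes>\<^sub>M lborel) (case_prod (\<lambda>u w. F (u, w)))"
    by (simp add: set_lebesgue_integral_def Feq lborel_prod case_prod_beta')
  also have "\<dots> = (\<integral>w. (\<integral>u. F (u, w) \<partial>lborel) \<partial>lborel)"
    by (rule lborel_pair.integral_snd[OF Fi', symmetric])
  also have "\<dots> = (\<integral>w. exp (- c * (norm w)\<^sup>2) *\<^sub>R cnj (G (flow (- complex_of_real ((norm (w::complex^'k))\<^sup>2)) x)) \<partial>lborel)"
    by (rule integral_cong_AE[OF borel_measurable_integrable[OF lborel_pair.integrable_snd[OF Fi']] Gm AE])
  also have "\<dots> = (\<integral>w. cnj (exp (- c * (norm w)\<^sup>2) *\<^sub>R G (flow (- complex_of_real ((norm (w::complex^'k))\<^sup>2)) x)) \<partial>lborel)"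
    by (simp del: Bochner_Integration.integral_cnj)
  also have "\<dots> = cnj (\<integral>w. exp (- c * (norm w)\<^sup>2) *\<^sub>R G (flow (- complex_of_real ((norm (w::complex^'k))\<^sup>2)) x) \<partial>lborel)"
    by (rule Bochner_Integration.integral_cnj)
  finally show ?thesis
    using bergman_kernel_hermitian[OF K K x y] by (simp add: G_def)
qed

text \<open>Along a backward orbit the \<open>\<psi> j\<close> are successive derivatives up to
  sign, and \<open>K_eq_gaussian_mean\<close> presents \<open>\<psi> 0\<close> as an integral of
  \<phi>; inverting that integral costs exactly as many derivatives as w has coordinates.\<close>

lemma KV_at_zero:
  assumes x: "x \<in> \<Omega>" and y: "y \<in> \<Omega>"
  shows "(euler_op Z \<gamma> ^^ CARD('k)) (\<lambda>u. K u y) x = (pi ^ CARD('k)) *\<^sub>R KV (x, 0) (y, 0)"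
proof -
  define G where "G u = KV (u, 0) (y, 0)" for u
  have cG: "continuous_on \<Omega> G"
    unfolding G_def by (rule holo_on_sm_imp_continuous_on[OF holo_KV_slice[OF y]])
  define f where "f j = (euler_op Z \<gamma> ^^ j) (\<lambda>u. K u y)" for j
  have hf: "holo_on_sm (*s) \<Omega> (f j)" for j
    unfolding f_def by (rule holo_on_euler_op_iter[OF \<Omega> holo_K[OF y]])
  have "continuous_on UNIV (\<lambda>t. flow (complex_of_real t) x)" by (intro continuous_intros)
  then have "open ((\<lambda>t. flow (complex_of_real t) x) -` \<Omega>)"
    by (intro continuous_open_vimage \<Omega>) (simp add: continuous_on_eq_continuous_at)
  moreover have "0 \<in> (\<lambda>t. flow (complex_of_real t) x) -` \<Omega>" using x by simp
  ultimately obtain d where d: "d > 0" "cball 0 d \<subseteq> (\<lambda>t. flow (complex_of_real t) x) -` \<Omega>"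
    using open_contains_cball by blast
  \<comment> \<open>The orbit starts slightly upstream, which openness of \<Omega> permits, so that
    x is reached at the positive time d, where two-sided derivatives are available.\<close>
  define x0 where "x0 = flow (complex_of_real d) x"
  have "d \<in> cball 0 d" using d by simp
  then have x0: "x0 \<in> \<Omega>" using d(2) unfolding x0_def by blast
  have mem: "flow (- complex_of_real t) x0 \<in> \<Omega>" if "t \<ge> 0" for t
    using that x0 by (intro flow_nonpos_mem) auto
  have ret: "flow (- complex_of_real d) x0 = x" by (simp add: x0_def dscale_zexp_add)
  define \<phi> where "\<phi> t = exp (- c * t) *\<^sub>R G (flow (- complex_of_real t) x0)" for t
  define \<psi> where "\<psi> j s = exp (- c * s) *\<^sub>R f j (flow (- complex_of_real s) x0)" for j s
  obtain B where B: "\<And>t. t \<ge> 0 \<Longrightarrow> cmod (G (flow (- complex_of_real t) x0)) \<le> B"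
    using orbit_bounded[OF cG x0] by blast
  have "\<psi> CARD('k) d = (pi ^ CARD('k)) *\<^sub>R \<phi> d"
  proof (rule iterated_derivative_integral_norm_square[OF c_pos])
    show "continuous_on {0..} \<phi>"
      unfolding \<phi>_def by (intro continuous_intros continuous_on_compose2[OF cG]) (auto intro: mem)
    show "cmod (\<phi> t) \<le> B * exp (- c * t)" if "t \<ge> 0" for t
      using B[OF that] by (simp add: \<phi>_def mult.commute)
    show "(\<psi> j has_vector_derivative - \<psi> (Suc j) s) (at s)" if "s > 0" for j s
      using euler_flow_has_vector_derivative[OF hf[of j], of Z \<gamma> s x0] mem[of s] that
      unfolding \<psi>_def c_def f_def by simp
    show "\<psi> 0 s = (\<integral>(w::complex^'k). \<phi> ((norm w)\<^sup>2 + s) \<partial>lborel)" if s: "s > 0" for s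
    proof -
      have "\<psi> 0 s = exp (- c * s) *\<^sub>R K (flow (- complex_of_real s) x0) y" by (simp add: \<psi>_def f_def)
      also have "\<dots> = exp (- c * s) *\<^sub>R (\<integral>w. exp (- c * (norm w)\<^sup>2) *\<^sub>R G (flow (- complex_of_real ((norm (w::complex^'k))\<^sup>2)) (flow (- complex_of_real s) x0)) \<partial>lborel)"
        using K_eq_gaussian_mean[OF mem y, of s] s by (simp add: G_def)
      also have "\<dots> = (\<integral>w. exp (- c * s) *\<^sub>R (exp (- c * (norm w)\<^sup>2) *\<^sub>R G (flow (- complex_of_real ((norm (w::complex^'k))\<^sup>2)) (flow (- complex_of_real s) x0))) \<partial>lborel)"
        by (rule integral_scaleR_right[symmetric])
      \<comment> \<open>Semigroup law: flowing for time s and then |w|^2 is flowing for their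
        sum.\<close>
      also have "\<dots> = (\<integral>(w::complex^'k). \<phi> ((norm w)\<^sup>2 + s) \<partial>lborel)"
        by (intro Bochner_Integration.integral_cong refl)
           (simp add: \<phi>_def dscale_zexp_add algebra_simps exp_add[symmetric])
      finally show ?thesis .
    qed
  qed (rule d)
  then have "exp (- c * d) *\<^sub>R f CARD('k) x = exp (- c * d) *\<^sub>R (pi ^ CARD('k) *\<^sub>R G x)"
    unfolding \<psi>_def \<phi>_def ret by (simp only: scaleR_left_commute)
  then show ?thesis
    unfolding scaleR_cancel_left by (simp add: f_def G_def)
qed

text \<open>An automorphism carries the second point to (y', 0), where independence of w and the
  formula on the zero slice take over.\<close>

lemma KV_eq:
  assumes p: "(x, w) \<in> V" and q: "(y, e) \<in> V"
  shows "KV (x, w) (y, e) = exp (complex_of_real c * cinner w e) / complex_of_real (pi ^ CARD('k)) *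
     (euler_op Z \<gamma> ^^ CARD('k)) (\<lambda>u. K u (flow (complex_of_real ((norm e)\<^sup>2 / 2)) y)) (flow (cinner w e - complex_of_real ((norm e)\<^sup>2 / 2)) x)"
proof -
  \<comment> \<open>This constant balances |w - e|^2 = |w|^2 - 2 Re <w, e> + |e|^2, so that
    \<open>T\<close> preserves \<open>V\<close>. Only real parts of times have to match, since
    imaginary times rotate.\<close>
  define b where "b = - complex_of_real ((norm e)\<^sup>2 / 2)"
  define T where "T = skew Z \<gamma> e b 1 (- e)"
  have VO: "open V" using \<Omega> by (rule open_V_gamma)
  have inv: "T p \<in> V \<longleftrightarrow> p \<in> V" for p
  proof -
    define a where "a = complex_of_real ((norm (snd p - e))\<^sup>2 / 2) + (cinner (snd p) e + b)"
    have "(norm (snd p - e))\<^sup>2 = (norm (snd p))\<^sup>2 - 2 * (snd p \<bullet> e) + (norm e)\<^sup>2"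
      by (simp add: power2_norm_eq_inner inner_diff_left inner_diff_right inner_commute)
    then have re: "Re a = Re (complex_of_real ((norm (snd p))\<^sup>2 / 2))"
      by (simp add: a_def b_def Re_cinner field_simps)
    have "T p \<in> V \<longleftrightarrow> flow a (fst p) \<in> \<Omega>"
      by (simp add: T_def V_gamma_iff skew_def dscale_zexp_add a_def)
    also have "\<dots> \<longleftrightarrow> p \<in> V"
      unfolding V_gamma_iff using re flow_mem by (metis order_refl)
    finally show ?thesis .
  qed
  define x' where "x' = flow (cinner w e + b) x"
  define y' where "y' = flow (cinner e e + b) y"
  have Tp: "T (x, w) = (x', w - e)" and Tq: "T (y, e) = (y', 0)"
    by (simp_all add: T_def skew_def x'_def y'_def)
  have p': "(x', w - e) \<in> V" and q': "(y', 0) \<in> V" using p q inv Tp Tq by metis+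
  have x': "x' \<in> \<Omega>" and y': "y' \<in> \<Omega>" using V_fst_mem[OF p'] V_fst_mem[OF q'] by simp_all
  have eb: "cinner e e + b = complex_of_real ((norm e)\<^sup>2 / 2)" by (simp add: b_def cinner_self)
  have "KV (x, w) (y, e) = exp (complex_of_real c * (cinner w e + b)) * cnj (exp (complex_of_real c * (cinner e e + b))) * KV (T (x, w)) (T (y, e))"
    using bergman_kernel_skew[OF VO KV, of 1 Z \<gamma> e b "- e" "(x, w)" "(y, e)"] inv p q
    by (simp add: T_def c_def)
  \<comment> \<open>The time is |e|^2/2 at the second point and contains -|e|^2/2 at the first, so
    these contributions cancel.\<close>
  also have "exp (complex_of_real c * (cinner w e + b)) * cnj (exp (complex_of_real c * (cinner e e + b))) = exp (complex_of_real c * cinner w e)"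
    unfolding eb by (simp add: exp_cnj exp_add[symmetric] b_def algebra_simps)
  also have "KV (T (x, w)) (T (y, e)) = KV (x', 0) (y', 0)"
    unfolding Tp Tq by (rule KV_indep_w[OF p' y'])
  also have "KV (x', 0) (y', 0) = (euler_op Z \<gamma> ^^ CARD('k)) (\<lambda>u. K u y') x' / complex_of_real (pi ^ CARD('k))"
    unfolding KV_at_zero[OF x' y'] by (simp add: scaleR_conv_of_real)
  finally show ?thesis unfolding x'_def y'_def eb by (simp add: b_def)
qed

end

section \<open>From the zero slice to an arbitrary slice\<close>

theorem theorem5:
  fixes Z :: "'a::finite set" and \<gamma> :: "'a \<Rightarrow> real" and \<Omega> :: "(complex^'a) set"
    and KV :: "(complex^'a) \<times> (complex^'k::finite) \<Rightarrow> (complex^'a) \<times> (complex^'k) \<Rightarrow> complex"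
    and Ks :: "complex^'k \<Rightarrow> complex^'a \<Rightarrow> complex^'a \<Rightarrow> complex"
  assumes "Z \<noteq> {}"
    and "is_domain \<Omega>"
    and "star_hartogs Z \<Omega>"
    and "\<forall>j\<in>Z. \<gamma> j > 0"
    and "is_bergman_kernel2 (V_gamma Z \<gamma> \<Omega>) KV"
    and "\<forall>e. is_bergman_kernel (V_slice Z \<gamma> \<Omega> e) (Ks e)"
  shows "\<forall>(x, w) \<in> V_gamma Z \<gamma> \<Omega>. \<forall>(y, e) \<in> V_gamma Z \<gamma> \<Omega>.
     KV (x, w) (y, e) =
       exp (complex_of_real (\<Sum>j\<in>Z. \<gamma> j) * (cinner w e - complex_of_real ((norm e)\<^sup>2)))
         / complex_of_real (pi ^ CARD('k))
       * ((euler_op Z \<gamma> ^^ CARD('k)) (\<lambda>x'. Ks e (l_map Z \<gamma> x' w e) y) x)"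
proof (clarify)
  fix x w y e assume p: "(x, w :: complex^'k) \<in> V_gamma Z \<gamma> \<Omega>" and q: "(y, e :: complex^'k) \<in> V_gamma Z \<gamma> \<Omega>"
  have \<Omega>: "open \<Omega>" using assms(2) by (simp add: is_domain_def)
  have Ks: "is_bergman_kernel_sm (*s) (V_slice Z \<gamma> \<Omega> e) (Ks e)" for e
    using assms(6) unfolding is_bergman_kernel_def by blast
  interpret hartogs_kernels Z \<gamma> \<Omega> KV "Ks 0"
    using assms \<Omega> Ks[of 0] by unfold_locales (simp_all add: is_bergman_kernel2_def V_slice_0)
  define n where "n = complex_of_real ((norm e)\<^sup>2)"
  define y' where "y' = flow (n / 2) y"
  \<comment> \<open>\<open>l_map\<close> scales by time <w, e> - |e|^2, and identifying the slice
    with \<Omega> adds |e|^2/2; \<tau> is the sum.\<close>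
  define \<tau> where "\<tau> = cinner w e - n / 2"
  have nn: "n / 2 = complex_of_real ((norm e)\<^sup>2 / 2)" by (simp add: n_def)
  have y': "y' \<in> \<Omega>" using q by (simp add: V_gamma_iff y'_def n_def)
  have slice: "flow (n / 2) u \<in> \<Omega> \<longleftrightarrow> u \<in> V_slice Z \<gamma> \<Omega> e" for u
    by (simp add: V_slice_iff n_def)
  have contfl: "continuous_on UNIV (flow t)" for t by (intro continuous_intros)
  have opfl: "open (flow t -` \<Omega>)" for t
    using contfl[of t] by (intro continuous_open_vimage \<Omega>) (simp add: continuous_on_eq_continuous_at)
  have oS: "open (V_slice Z \<gamma> \<Omega> e)"
  proof -
    have "V_slice Z \<gamma> \<Omega> e = flow (n / 2) -` \<Omega>" using slice by auto
    then show ?thesis using opfl by simp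
  qed
  \<comment> \<open>The slice is \<Omega> scaled by time -n/2, and the Jacobian enters once for each
    argument of the kernel. The resulting factor exp(c n) is what turns the prefactor exp(c (<w, e>
    - n)) of the claim into exp(c <w, e>).\<close>
  have Kse: "Ks e u y = exp (complex_of_real c * n) * Ks 0 (flow (n / 2) u) y'" if u: "u \<in> V_slice Z \<gamma> \<Omega> e" for u
  proof -
    have "y \<in> V_slice Z \<gamma> \<Omega> e" using q by (simp add: V_slice_def)
    from bergman_kernel_unique[OF Ks bergman_kernel_dscale[OF oS \<Omega> zexp_nonzero slice K] u this]
    have "Ks e u y = exp (complex_of_real c * (n / 2)) * cnj (exp (complex_of_real c * (n / 2))) * Ks 0 (flow (n / 2) u) y'"
      by (simp add: prod_zexp c_def y'_def)
    also have "exp (complex_of_real c * (n / 2)) * cnj (exp (complex_of_real c * (n / 2))) = exp (complex_of_real c * n)"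
      by (simp add: n_def exp_cnj exp_add[symmetric])
    finally show ?thesis .
  qed
  have ev: "Ks e (l_map Z \<gamma> x' w e) y = exp (complex_of_real c * n) * Ks 0 (flow \<tau> x') y'" if "flow \<tau> x' \<in> \<Omega>" for x'
  proof -
    have l: "flow (n / 2) (l_map Z \<gamma> x' w e) = flow \<tau> x'"
      by (simp add: l_map_eq dscale_zexp_add \<tau>_def n_def algebra_simps)
    with that have "l_map Z \<gamma> x' w e \<in> V_slice Z \<gamma> \<Omega> e" by (simp only: slice[symmetric])
    from Kse[OF this] show ?thesis by (simp add: l)
  qed
  have x\<tau>: "flow \<tau> x \<in> \<Omega>"
  proof -
    \<comment> \<open>Nonnegativity of |w - e|^2 bounds the real part of \<tau> by |w|^2/2, so the
      slice kernel is evaluated and differentiated inside its domain.\<close>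
    have "0 \<le> (norm (w - e))\<^sup>2" by simp
    also have "(norm (w - e))\<^sup>2 = (norm w)\<^sup>2 - 2 * (w \<bullet> e) + (norm e)\<^sup>2"
      by (simp add: power2_norm_eq_inner inner_diff_left inner_diff_right inner_commute)
    finally have "Re \<tau> \<le> Re (complex_of_real ((norm w)\<^sup>2 / 2))" by (simp add: \<tau>_def n_def Re_cinner)
    with p show ?thesis using flow_mem unfolding V_gamma_iff by simp
  qed
  have "(euler_op Z \<gamma> ^^ CARD('k)) (\<lambda>x'. Ks e (l_map Z \<gamma> x' w e) y) x
      = (euler_op Z \<gamma> ^^ CARD('k)) (\<lambda>x'. exp (complex_of_real c * n) * Ks 0 (flow \<tau> x') y') x"
    by (rule euler_op_iter_cong[OF opfl[of \<tau>]]) (use ev x\<tau> in auto)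
  also have "\<dots> = exp (complex_of_real c * n) * (euler_op Z \<gamma> ^^ CARD('k)) (\<lambda>u. Ks 0 u y') (flow \<tau> x)"
    by (rule euler_op_iter_dscale_cmult[OF \<Omega> holo_K[OF y'] x\<tau>])
  finally have "exp (complex_of_real c * (cinner w e - n)) / complex_of_real (pi ^ CARD('k))
       * ((euler_op Z \<gamma> ^^ CARD('k)) (\<lambda>x'. Ks e (l_map Z \<gamma> x' w e) y) x)
     = (exp (complex_of_real c * (cinner w e - n)) * exp (complex_of_real c * n)) / complex_of_real (pi ^ CARD('k))
       * (euler_op Z \<gamma> ^^ CARD('k)) (\<lambda>u. Ks 0 u y') (flow \<tau> x)"
    by simp
  also have "exp (complex_of_real c * (cinner w e - n)) * exp (complex_of_real c * n) = exp (complex_of_real c * cinner w e)"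
    by (simp add: exp_add[symmetric] algebra_simps)
  also have "exp (complex_of_real c * cinner w e) / complex_of_real (pi ^ CARD('k))
       * (euler_op Z \<gamma> ^^ CARD('k)) (\<lambda>u. Ks 0 u y') (flow \<tau> x) = KV (x, w) (y, e)"
    unfolding KV_eq[OF p q] y'_def \<tau>_def nn ..
  finally show "KV (x, w) (y, e) =
       exp (complex_of_real (\<Sum>j\<in>Z. \<gamma> j) * (cinner w e - complex_of_real ((norm e)\<^sup>2)))
         / complex_of_real (pi ^ CARD('k))
       * ((euler_op Z \<gamma> ^^ CARD('k)) (\<lambda>x'. Ks e (l_map Z \<gamma> x' w e) y) x)"
    unfolding c_def n_def ..
qed

end
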